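(* Fix a point $P\in\mathbb P$ and a coordinate $u$ with its pole at $P$. Let $z_1,z_2\in\mathbb P\setminus P$, $z_2\ne z_1$, let $\mathtt v\in\mathbf W^{z_1}$, and set $\hat S(z)=\hat e^3(z)+3\hat e^2(z)\hat i(z)+3\hat e(z)\hat i^2(z)+\hat i^3(z)$. Then, as $z_2\to z_1$, $$\Bigl[2\,\hat T(z_2)\hat b(z_1)-\frac{2}{(u(z_2)-u(z_1))^2}\,\hat b(z_1)-\frac{2}{u(z_2)-u(z_1)}\,\hat b'(z_1)\Bigr]\mathtt v\ \longrightarrow\ \bigl[\hat S(z_1)+\hat b''(z_1)\bigr]\mathtt v ,$$ where $\hat b'$ and $\hat b''$ are the first and second derivatives of the field $\hat b$ with respect to the vector field $d/du$.
   Context: $\mathbb P$ is a complex projective line; $K$ its canonical bundle, $K_z$ the fibre at $z$. A coordinate is a meromorphic function $u$ on $\mathbb P$ with exactly one pole, which is simple; $du_z\in K_z$ is the value of $du$ at $z$. $\mathbf K$ is the space of meromorphic 1-forms on $\mathbb P$ with all residues zero, $\mathbf K^z\subset\mathbf K$ the subspace of forms regular at $z$; $\mathbf W=S^*\mathbf K$, $\mathbf W^z=S^*\mathbf K^z$ are the symmetric algebras. Fields: $e(z):\mathbf W\to\mathbf W\otimes K_z$ is multiplication by $e_z=-\frac{du}{(u-u(z))^2}\otimes du_z$. $i(z):\mathbf W^z\to\mathbf W^z\otimes K_z$ is the derivation with $i(z)\mathbf 1=0$ and $i(z)\alpha=-\alpha(z)$ for $\alpha\in\mathbf K^z$. $b(z)=i(z)+e(z):\mathbf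 W^z\to\mathbf W\otimes K_z$. $T(z)=\tfrac12\{i(z)\circ i(z)+e(z)\circ e(z)+2e(z)\circ i(z)\}:\mathbf W^z\to\mathbf W\otimes K_z^2$. With the coordinate $u$ chosen, one writes $e(z)=\hat e(z)du_z$, $i(z)=\hat i(z)du_z$, $b(z)=\hat b(z)du_z$, $T(z)=\hat T(z)du_z^2$; the derivatives of $\hat b$ are taken with respect to the variable $u(z)$. Limits: for $\mathtt v\in\mathbf W^{z_1}$ the expressions are defined for $z_2\ne z_1$ in a Zariski neighbourhood of $z_1$ (depending on $\mathtt v$). The degree $m$ component of the expression is a symmetric polydifferential in $m$ auxiliary points depending rationally on those points and on $u(z_2)$; the limit statement means that each component has no pole along $z_2=z_1$ and that its restriction to $z_2=z_1$ is the corresponding component of the right side. *)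

theory Defs
  imports
    "HOL-Computational_Algebra.Computational_Algebra"
    "HOL-Computational_Algebra.Field_as_Ring"
    "HOL-Library.Poly_Mapping"
    "HOL-Combinatorics.Permutations"
begin

section \<open>Meromorphic functions and 1-forms on the projective line\<close>

text \<open>
  The projective line is the set of finite points together with one point at infinity. Its field
  of meromorphic functions is the field of rational functions in the reference coordinate
  \<open>ref_coord\<close>. The coordinate \<open>u\<close> of the main statement is an arbitrary one, unrelated to
  \<open>ref_coord\<close>, and its pole may be any point.
\<close>

datatype proj_line = Fin complex | Infty

type_synonym mero = "complex poly fract"

abbreviation cst :: "complex \<Rightarrow> mero" where
  "cst c \<equiv> to_fract [:c:]"

definition ref_coord :: mero where
  "ref_coord = to_fract [:0, 1:]"

text \<open>Substitute \<open>y\<close>, an element of an extension field of the complex numbers (embedded by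
  \<open>h\<close>) that is transcendental over them, for the variable of a rational function.\<close>

definition subst_fract :: "(complex \<Rightarrow> 'b::field) \<Rightarrow> mero \<Rightarrow> 'b \<Rightarrow> 'b" where
  "subst_fract h f y = (case quot_of_fract f of (p, q) \<Rightarrow>
     poly (map_poly h p) y / poly (map_poly h q) y)"

text \<open>Laurent expansion at a point in the local parameter \<open>ref_coord - a\<close> at \<open>Fin a\<close> and
  \<open>1 / ref_coord\<close> at infinity.\<close>

fun expand :: "proj_line \<Rightarrow> mero \<Rightarrow> complex fls" where
  "expand (Fin a) f = subst_fract fls_const f (fls_const a + fls_X)"
| "expand Infty f = subst_fract fls_const f fls_X_inv"

definition regular_at :: "mero \<Rightarrow> proj_line \<Rightarrow> bool" where
  "regular_at f z \<longleftrightarrow> fls_subdegree (expand z f) \<ge> 0"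

definition value_at :: "mero \<Rightarrow> proj_line \<Rightarrow> complex" where
  "value_at f z = fls_nth (expand z f) 0"

definition coordinate_with_pole :: "mero \<Rightarrow> proj_line \<Rightarrow> bool" where
  "coordinate_with_pole u P \<longleftrightarrow>
     fls_subdegree (expand P u) = -1 \<and> (\<forall>z. z \<noteq> P \<longrightarrow> regular_at u z)"

text \<open>A meromorphic 1-form \<open>f d(ref_coord)\<close> is represented by its coefficient \<open>f\<close>. Thus the
  differential of a function is represented by its derivative with respect to \<open>ref_coord\<close>.\<close>

type_synonym mero_form = mero

definition differential :: "mero \<Rightarrow> mero_form" where
  "differential f = (case quot_of_fract f of (p, q) \<Rightarrow>
     to_fract (pderiv p * q - p * pderiv q) / to_fract (q ^ 2))"

text \<open>The expansion \<open>\<phi>\<close> of a form, written as \<open>\<phi>(X) dX\<close> in the local parameter \<open>X\<close>.\<close>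

definition expand_form :: "proj_line \<Rightarrow> mero_form \<Rightarrow> complex fls" where
  "expand_form z \<omega> = expand z \<omega> * fls_deriv (expand z ref_coord)"

definition form_residue :: "mero_form \<Rightarrow> proj_line \<Rightarrow> complex" where
  "form_residue \<omega> z = fls_residue (expand_form z \<omega>)"

definition form_regular_at :: "mero_form \<Rightarrow> proj_line \<Rightarrow> bool" where
  "form_regular_at \<omega> z \<longleftrightarrow> fls_subdegree (expand_form z \<omega>) \<ge> 0"

text \<open>The value of a form in the fibre of the canonical bundle at \<open>z\<close>, as a multiple of \<open>du\<close>
  at \<open>z\<close>; meaningful where the form and \<open>u\<close> are regular.\<close>

definition form_value :: "mero \<Rightarrow> mero_form \<Rightarrow> proj_line \<Rightarrow> complex" where
  "form_value u \<omega> z = value_at (\<omega> / differential u) z"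

text \<open>The space \<open>\<^bold>K\<close>.\<close>

typedef kform = "{\<omega> :: mero_form. \<forall>z. form_residue \<omega> z = 0}"
proof
  have "expand z 0 = 0" for z
    by (cases z) (simp_all add: subst_fract_def)
  then show "0 \<in> {\<omega> :: mero_form. \<forall>z. form_residue \<omega> z = 0}"
    by (simp add: form_residue_def expand_form_def)
qed

section \<open>The symmetric algebra\<close>

text \<open>\<open>\<^bold>W\<close> is the free commutative algebra on the set \<open>\<^bold>K\<close> modulo the ideal that makes
  the inclusion of the generators complex-linear.\<close>

type_synonym free_alg = "(kform \<Rightarrow>\<^sub>0 nat) \<Rightarrow>\<^sub>0 complex"

definition free_gen :: "kform \<Rightarrow> free_alg" where
  "free_gen \<alpha> = Poly_Mapping.single (Poly_Mapping.single \<alpha> 1) 1"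

definition free_const :: "complex \<Rightarrow> free_alg" where
  "free_const c = Poly_Mapping.single 0 c"

inductive_set sym_ideal :: "free_alg set" where
  zero: "0 \<in> sym_ideal"
| add_rel: "Rep_kform \<gamma> = Rep_kform \<alpha> + Rep_kform \<beta> \<Longrightarrow>
    p * (free_gen \<gamma> - (free_gen \<alpha> + free_gen \<beta>)) \<in> sym_ideal"
| scale_rel: "Rep_kform \<gamma> = cst c * Rep_kform \<alpha> \<Longrightarrow>
    p * (free_gen \<gamma> - free_const c * free_gen \<alpha>) \<in> sym_ideal"
| sum: "a \<in> sym_ideal \<Longrightarrow> b \<in> sym_ideal \<Longrightarrow> a + b \<in> sym_ideal"

lemma sym_ideal_mult: "a \<in> sym_ideal \<Longrightarrow> r * a \<in> sym_ideal"
proof (induction rule: sym_ideal.induct)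
  case (add_rel \<gamma> \<alpha> \<beta> p)
  then show ?case using sym_ideal.add_rel[of \<gamma> \<alpha> \<beta> "r * p"] by (simp add: mult.assoc)
next
  case (scale_rel \<gamma> c \<alpha> p)
  then show ?case using sym_ideal.scale_rel[of \<gamma> c \<alpha> "r * p"] by (simp add: mult.assoc)
next
  case (sum a b)
  then show ?case by (simp add: distrib_left sym_ideal.sum)
qed (simp add: sym_ideal.zero)

lemma sym_ideal_uminus: "a \<in> sym_ideal \<Longrightarrow> - a \<in> sym_ideal"
  using sym_ideal_mult[of a "- 1"] by simp

definition sym_rel :: "free_alg \<Rightarrow> free_alg \<Rightarrow> bool" where
  "sym_rel p q \<longleftrightarrow> p - q \<in> sym_ideal"

quotient_type sym = free_alg / sym_rel
proof (rule equivpI)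
  show "reflp sym_rel"
    by (simp add: reflp_def sym_rel_def sym_ideal.zero)
  show "symp sym_rel"
  proof (rule sympI)
    fix a b assume "sym_rel a b"
    then show "sym_rel b a" using sym_ideal_uminus[of "a - b"] by (simp add: sym_rel_def)
  qed
  show "transp sym_rel"
  proof (rule transpI)
    fix a b c assume "sym_rel a b" "sym_rel b c"
    then show "sym_rel a c" using sym_ideal.sum[of "a - b" "b - c"] by (simp add: sym_rel_def)
  qed
qed

lemma lookup_mult_single_zero:
  fixes p :: free_alg
  assumes "k \<noteq> 0"
  shows "Poly_Mapping.lookup (p * Poly_Mapping.single k c) 0 = 0"
proof -
  have "Poly_Mapping.lookup (p * Poly_Mapping.single k c) 0 \<noteq> 0 \<Longrightarrow> k = 0"
  proof -
    assume "Poly_Mapping.lookup (p * Poly_Mapping.single k c) 0 \<noteq> 0"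
    then have "0 \<in> Poly_Mapping.keys (p * Poly_Mapping.single k c)"
      by (simp add: in_keys_iff)
    then obtain a b where "a + b = 0" "b \<in> Poly_Mapping.keys (Poly_Mapping.single k c)"
      using keys_mult[of p "Poly_Mapping.single k c"] by auto
    then have *: "a + k = 0" by (auto split: if_splits)
    have "Poly_Mapping.lookup k x = 0" for x
      using arg_cong[OF *, of "\<lambda>m. Poly_Mapping.lookup m x"] by (simp add: lookup_add)
    then show "k = 0" by (simp add: poly_mapping_eqI)
  qed
  with assms show ?thesis by blast
qed

lemma sym_ideal_no_const: "a \<in> sym_ideal \<Longrightarrow> Poly_Mapping.lookup a 0 = 0"
proof (induction rule: sym_ideal.induct)
  case (scale_rel \<gamma> c \<alpha> p)
  have nz: "Poly_Mapping.single \<beta> (1::nat) \<noteq> 0" for \<beta> :: kform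
    by (metis lookup_single_eq lookup_zero zero_neq_one)
  show ?case
    unfolding right_diff_distrib lookup_minus mult.assoc[symmetric] free_gen_def
    by (simp only: lookup_mult_single_zero[OF nz] diff_self)
next
  case (add_rel \<gamma> \<alpha> \<beta> p)
  have nz: "Poly_Mapping.single \<beta> (1::nat) \<noteq> 0" for \<beta> :: kform
    by (metis lookup_single_eq lookup_zero zero_neq_one)
  show ?case
    unfolding right_diff_distrib distrib_left lookup_minus lookup_add free_gen_def
    by (simp only: lookup_mult_single_zero[OF nz] diff_self add_0)
qed (simp_all add: lookup_add)

instantiation sym :: comm_ring_1
begin

lift_definition zero_sym :: sym is 0 .
lift_definition one_sym :: sym is 1 .

lift_definition plus_sym :: "sym \<Rightarrow> sym \<Rightarrow> sym" is "(+)"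
proof -
  fix a b c d assume "sym_rel a b" "sym_rel c d"
  then show "sym_rel (a + c) (b + d)"
    using sym_ideal.sum[of "a - b" "c - d"] by (simp add: sym_rel_def algebra_simps)
qed

lift_definition uminus_sym :: "sym \<Rightarrow> sym" is uminus
proof -
  fix a b assume "sym_rel a b"
  then show "sym_rel (- a) (- b)"
    using sym_ideal_uminus[of "a - b"] by (simp add: sym_rel_def algebra_simps)
qed

lift_definition minus_sym :: "sym \<Rightarrow> sym \<Rightarrow> sym" is "(-)"
proof -
  fix a b c d assume "sym_rel a b" "sym_rel c d"
  then show "sym_rel (a - c) (b - d)"
    using sym_ideal.sum[of "a - b" "- (c - d)"] sym_ideal_uminus[of "c - d"]
    by (simp add: sym_rel_def algebra_simps)
qed

lift_definition times_sym :: "sym \<Rightarrow> sym \<Rightarrow> sym" is "(*)"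
proof -
  fix a b c d assume "sym_rel a b" "sym_rel c d"
  then have "c * (a - b) + b * (c - d) \<in> sym_ideal"
    by (intro sym_ideal.sum sym_ideal_mult) (simp_all add: sym_rel_def)
  then show "sym_rel (a * c) (b * d)"
    by (simp add: sym_rel_def algebra_simps)
qed

instance
proof
  show "(0 :: sym) \<noteq> 1"
  proof transfer
    show "\<not> sym_rel 0 1"
      using sym_ideal_no_const[of "0 - 1"] by (auto simp: sym_rel_def lookup_one)
  qed
qed (transfer; simp add: sym_rel_def algebra_simps sym_ideal.zero)+

end

lift_definition scalar :: "complex \<Rightarrow> sym" is free_const .

lift_definition gen :: "kform \<Rightarrow> sym" is free_gen .

definition K_reg :: "proj_line \<Rightarrow> kform set" where
  "K_reg z = {\<alpha>. form_regular_at (Rep_kform \<alpha>) z}"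

text \<open>\<open>\<^bold>W\<close>\<open>\<^sup>z\<close>, realised inside \<open>\<^bold>W\<close> as the subalgebra generated by
  the forms regular at \<open>z\<close>.\<close>

inductive_set W_reg :: "proj_line \<Rightarrow> sym set" for z where
  "scalar c \<in> W_reg z"
| "\<alpha> \<in> K_reg z \<Longrightarrow> gen \<alpha> \<in> W_reg z"
| "v \<in> W_reg z \<Longrightarrow> w \<in> W_reg z \<Longrightarrow> v + w \<in> W_reg z"
| "v \<in> W_reg z \<Longrightarrow> w \<in> W_reg z \<Longrightarrow> v * w \<in> W_reg z"

section \<open>The fields\<close>

text \<open>All fields are the ``hatted'' ones: the coefficients of powers of \<open>du\<close> at \<open>z\<close>, for a
  coordinate \<open>u\<close> and a point \<open>z\<close> other than its pole.\<close>

definition e_form :: "mero \<Rightarrow> proj_line \<Rightarrow> kform" where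
  "e_form u z = Abs_kform (- (differential u / (u - cst (value_at u z)) ^ 2))"

definition e_hat :: "mero \<Rightarrow> proj_line \<Rightarrow> sym \<Rightarrow> sym" where
  "e_hat u z w = gen (e_form u z) * w"

definition is_i_hat :: "mero \<Rightarrow> proj_line \<Rightarrow> (sym \<Rightarrow> sym) \<Rightarrow> bool" where
  "is_i_hat u z D \<longleftrightarrow>
     (\<forall>v\<in>W_reg z. D v \<in> W_reg z) \<and>
     (\<forall>v\<in>W_reg z. \<forall>w\<in>W_reg z. D (v + w) = D v + D w) \<and>
     (\<forall>c. \<forall>v\<in>W_reg z. D (scalar c * v) = scalar c * D v) \<and>
     (\<forall>v\<in>W_reg z. \<forall>w\<in>W_reg z. D (v * w) = D v * w + v * D w) \<and>
     D 1 = 0 \<and>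
     (\<forall>\<alpha>\<in>K_reg z. D (gen \<alpha>) = scalar (- form_value u (Rep_kform \<alpha>) z))"

text \<open>The derivation is unique on \<open>W_reg z\<close>; its values elsewhere are meaningless.\<close>

definition i_hat :: "mero \<Rightarrow> proj_line \<Rightarrow> sym \<Rightarrow> sym" where
  "i_hat u z = (SOME D. is_i_hat u z D)"

definition b_hat :: "mero \<Rightarrow> proj_line \<Rightarrow> sym \<Rightarrow> sym" where
  "b_hat u z w = i_hat u z w + e_hat u z w"

definition T_hat :: "mero \<Rightarrow> proj_line \<Rightarrow> sym \<Rightarrow> sym" where
  "T_hat u z w = scalar (1/2) *
     (i_hat u z (i_hat u z w) + e_hat u z (e_hat u z w) + 2 * e_hat u z (i_hat u z w))"

definition S_hat :: "mero \<Rightarrow> proj_line \<Rightarrow> sym \<Rightarrow> sym" where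
  "S_hat u z w = (e_hat u z ^^ 3) w + 3 * (e_hat u z ^^ 2) (i_hat u z w)
     + 3 * e_hat u z ((i_hat u z ^^ 2) w) + (i_hat u z ^^ 3) w"

section \<open>Symmetric polydifferentials, limits and derivatives\<close>

text \<open>Rational functions of auxiliary points \<open>t\<^sub>0, t\<^sub>1, \<dots>\<close>, given by their reference
  coordinates. A polydifferential \<open>F dt\<^sub>0 \<cdots> dt\<^sub>m\<^sub>-\<^sub>1\<close> is represented by \<open>F\<close>.\<close>

type_synonym aux_fun = "((nat \<Rightarrow>\<^sub>0 nat) \<Rightarrow>\<^sub>0 complex) fract"

definition aux_const :: "complex \<Rightarrow> aux_fun" where
  "aux_const c = to_fract (Poly_Mapping.single 0 c)"

definition aux_point :: "nat \<Rightarrow> aux_fun" where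
  "aux_point j = to_fract (Poly_Mapping.single (Poly_Mapping.single j 1) 1)"

definition form_at_aux :: "kform \<Rightarrow> nat \<Rightarrow> aux_fun" where
  "form_at_aux \<alpha> j = subst_fract aux_const (Rep_kform \<alpha>) (aux_point j)"

text \<open>The degree \<open>m\<close> component of an element of \<open>\<^bold>W\<close> as a symmetric polydifferential in
  \<open>m\<close> points: the product of \<open>m\<close> forms corresponds to its (unnormalised) symmetrisation.
  These conditions determine the map.\<close>

definition is_component :: "nat \<Rightarrow> (sym \<Rightarrow> aux_fun) \<Rightarrow> bool" where
  "is_component m C \<longleftrightarrow>
     (\<forall>v w. C (v + w) = C v + C w) \<and>
     (\<forall>c v. C (scalar c * v) = aux_const c * C v) \<and>
     (\<forall>\<alpha>s. C (\<Prod>\<alpha>\<leftarrow>\<alpha>s. gen \<alpha>) =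
        (if length \<alpha>s = m
         then \<Sum>\<sigma> | \<sigma> permutes {..<m}. \<Prod>j<m. form_at_aux (\<alpha>s ! \<sigma> j) j
         else 0))"

definition component :: "nat \<Rightarrow> sym \<Rightarrow> aux_fun" where
  "component m = (SOME C. is_component m C)"

text \<open>Zariski neighbourhoods of \<open>z\<close> on which \<open>u\<close> has no pole.\<close>

definition zariski_nhd :: "mero \<Rightarrow> proj_line \<Rightarrow> proj_line set \<Rightarrow> bool" where
  "zariski_nhd u z U \<longleftrightarrow> z \<in> U \<and> finite (- U) \<and> (\<forall>y\<in>U. regular_at u y)"

text \<open>On the set \<open>A\<close>, the degree \<open>m\<close> component of a family \<open>F\<close> of elements of \<open>\<^bold>W\<close> is the
  rational function \<open>p / q\<close> of the auxiliary points and of \<open>s = u(z)\<close>; here \<open>p\<close> and \<open>q\<close> are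
  polynomials in \<open>s\<close> over the field of rational functions of the auxiliary points.\<close>

definition represents ::
  "mero \<Rightarrow> nat \<Rightarrow> (proj_line \<Rightarrow> sym) \<Rightarrow> proj_line set \<Rightarrow> aux_fun poly \<Rightarrow> aux_fun poly \<Rightarrow> bool" where
  "represents u m F A p q \<longleftrightarrow> (\<forall>z\<in>A.
     poly q (aux_const (value_at u z)) \<noteq> 0 \<and>
     component m (F z) = poly p (aux_const (value_at u z)) / poly q (aux_const (value_at u z)))"

text \<open>The limit of \<open>F(z)\<close> as \<open>z\<close> tends to \<open>z1\<close>: in each degree the rational function has no pole
  along \<open>z = z1\<close>, and it restricts there to the component of \<open>w\<close>.\<close>

definition tends_to_W :: "mero \<Rightarrow> (proj_line \<Rightarrow> sym) \<Rightarrow> proj_line \<Rightarrow> sym \<Rightarrow> bool" where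
  "tends_to_W u F z1 w \<longleftrightarrow> (\<forall>m. \<exists>U p q. zariski_nhd u z1 U \<and>
     represents u m F (U - {z1}) p q \<and>
     (let s = aux_const (value_at u z1) in
       poly q s \<noteq> 0 \<and> component m w = poly p s / poly q s))"

text \<open>The derivative with respect to \<open>u(z)\<close> of a family depending rationally on \<open>z\<close>, at
  \<open>z1\<close>: in each degree, the formal derivative of \<open>p / q\<close> in the variable \<open>s\<close>.\<close>

definition has_u_deriv :: "mero \<Rightarrow> (proj_line \<Rightarrow> sym) \<Rightarrow> proj_line \<Rightarrow> sym \<Rightarrow> bool" where
  "has_u_deriv u F z1 w \<longleftrightarrow> (\<forall>m. \<exists>U p q. zariski_nhd u z1 U \<and>
     represents u m F U p q \<and>
     (let s = aux_const (value_at u z1) in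
       component m w = poly (pderiv p * q - p * pderiv q) s / (poly q s) ^ 2))"

definition u_deriv :: "mero \<Rightarrow> (proj_line \<Rightarrow> sym) \<Rightarrow> proj_line \<Rightarrow> sym" where
  "u_deriv u F z = (SOME w. has_u_deriv u F z w)"

definition b_hat' :: "mero \<Rightarrow> proj_line \<Rightarrow> sym \<Rightarrow> sym" where
  "b_hat' u z v = u_deriv u (\<lambda>y. b_hat u y v) z"

definition b_hat'' :: "mero \<Rightarrow> proj_line \<Rightarrow> sym \<Rightarrow> sym" where
  "b_hat'' u z v = u_deriv u (\<lambda>y. b_hat' u y v) z"

end

theory Submission
  imports Defs
begin

text \<open>
  Write \<open>s = u(z)\<close>. Since \<open>u\<close> is a fractional linear function, every meromorphic function is a
  rational function of \<open>u\<close>; hence \<open>i(z)v\<close> and \<open>e(z)v\<close> depend rationally on \<open>s\<close>, and their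
  \<open>k\<close>-th derivatives are again a derivation of \<open>\<^bold>W\<close> (contraction with the \<open>k\<close>-th derivative
  of \<open>\<alpha>/du\<close>) and the multiplication by a form \<open>-(k+1)! du / (u - s)^(k+2)\<close> of \<open>\<^bold>K\<close>.

  As \<open>i(z\<^sub>2)\<close> is a derivation with \<open>i(z\<^sub>2) e\<^sub>z\<^sub>1 = 1/\<Delta>\<^sup>2\<close>, where \<open>\<Delta> = u(z\<^sub>2) - u(z\<^sub>1)\<close>, the product
  \<open>2 T(z\<^sub>2) b(z\<^sub>1) v\<close> is the sum of \<open>(2/\<Delta>\<^sup>2) b(z\<^sub>2) v\<close> and of terms without pole, which tend to
  \<open>S(z\<^sub>1) v\<close>. By Taylor's formula \<open>(2/\<Delta>\<^sup>2) (b(z\<^sub>2) v - b(z\<^sub>1) v - \<Delta> b'(z\<^sub>1) v)\<close> tends to \<open>b''(z\<^sub>1) v\<close>.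

  Components are accessible through Ryser's formula, which writes a symmetrised product of forms as
  an alternating sum of values of algebra homomorphisms on \<open>\<^bold>W\<close>; rational dependence on \<open>s\<close> and the
  product rule are then checked in a commutative ring.
\<close>

section \<open>Substitution into rational functions\<close>

text \<open>\<open>i_hat\<close>, \<open>component\<close> and \<open>u_deriv\<close> are Hilbert
  choices. The conditions behind the first two have an explicit solution and a uniqueness proof, so
  these can be replaced by \<open>contraction 0\<close> (on \<open>W_reg z\<close>) and by
  \<open>ryser_component\<close>. The choice behind \<open>u_deriv\<close> is constrained through
  components only; hence b' and b'' are never manipulated as elements of W, and the final comparison
  is made degree by degree.

  The poles match for a simple reason. In 2 T(z2) b(z1) v, Leibniz applied to the i i term yields
  (2/\<Delta>^2) i(z2) v and the 2 e i term yields (2/\<Delta>^2) e(z2) v. The contraction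
  1/\<Delta>^2 is a scalar, so a second contraction kills it and no higher pole arises. The sum is
  (2/\<Delta>^2) b(z2) v, and the two subtracted terms are exactly its first order Taylor
  polynomial.

  Expansions are taken in \<open>ref_coord\<close>, derivatives and limits in u(z). The bridge is
  that du has no zero away from P, which comes from the nonzero determinant of the fractional linear
  relation between the two coordinates.\<close>

lemma mero_cases:
  obtains p q where "q \<noteq> 0" "(f :: mero) = to_fract p / to_fract q"
  using Fract_quot_of_fract[of f] snd_quot_of_fract_nonzero[of f]
  unfolding Fract_conv_to_fract by metis

text \<open>Three substitutions share this interface: the local parameter expansion at a point, an
  auxiliary point t_j, and \<open>u\<close> itself in place of \<open>ref_coord\<close>.\<close>

locale subst_hom =
  fixes h :: "complex \<Rightarrow> 'b::field" and y :: 'b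
  assumes h_add: "h (a + b) = h a + h b"
    and h_mult: "h (a * b) = h a * h b"
    and h_one: "h 1 = 1"
    and transcendental: "y \<noteq> h c"
begin

lemma h_zero: "h 0 = 0"
  using h_add[of 0 0] by (metis add_0 add_cancel_right_left)

lemma h_uminus: "h (- a) = - h a"
  using h_add[of a "- a"] h_zero by (simp add: eq_neg_iff_add_eq_0 add.commute)

lemma h_eq_0_iff: "h a = 0 \<longleftrightarrow> a = 0"
proof
  assume "h a = 0"
  show "a = 0"
  proof (rule ccontr)
    assume "a \<noteq> 0"
    then have "h a * h (inverse a) = 1" by (simp flip: h_mult add: h_one)
    with \<open>h a = 0\<close> show False by simp
  qed
qed (simp add: h_zero)

definition psub :: "complex poly \<Rightarrow> 'b" where
  "psub p = poly (map_poly h p) y"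

abbreviation fsub :: "mero \<Rightarrow> 'b" where
  "fsub f \<equiv> subst_fract h f y"

lemma psub_pCons: "psub (pCons a p) = h a + y * psub p"
  by (simp add: psub_def map_poly_pCons h_zero)

lemma psub_0 [simp]: "psub 0 = 0"
  by (simp add: psub_def)

lemma psub_1 [simp]: "psub 1 = 1"
  by (simp add: one_pCons psub_pCons h_one)

lemma psub_add: "psub (p + q) = psub p + psub q"
  by (induction p q rule: poly_induct2) (simp_all add: psub_pCons h_add algebra_simps)

lemma psub_smult: "psub (smult c p) = h c * psub p"
  by (induction p) (simp_all add: psub_pCons h_mult algebra_simps)

lemma psub_mult: "psub (p * q) = psub p * psub q"
  by (induction p) (simp_all add: psub_pCons psub_add psub_smult h_zero algebra_simps)

lemma psub_diff: "psub (p - q) = psub p - psub q"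
  using psub_add[of "p - q" q] by simp

text \<open>Avoiding constants is enough for transcendence: the complex numbers are algebraically
  closed, so p splits into linear factors, none of which vanishes at y.\<close>

lemma psub_nonzero: "p \<noteq> 0 \<Longrightarrow> psub p \<noteq> 0"
proof (induction "degree p" arbitrary: p)
  case 0
  then obtain c where "p = [:c:]" by (metis degree_eq_zeroE)
  with 0 show ?case by (simp add: psub_pCons h_eq_0_iff)
next
  case (Suc n)
  have "\<not> constant (poly p)"
    using Suc.hyps(2) by (simp add: constant_degree)
  then obtain r where "poly p r = 0" using fundamental_theorem_of_algebra by blast
  then obtain q where q: "p = [:- r, 1:] * q" by (metis poly_eq_0_iff_dvd dvdE)
  then have "q \<noteq> 0" using Suc.prems by auto
  then have "degree p = Suc (degree q)" unfolding q by (subst degree_mult_eq) auto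
  with Suc \<open>q \<noteq> 0\<close> have "psub q \<noteq> 0" by simp
  moreover have "psub [:- r, 1:] \<noteq> 0"
    using transcendental[of r] by (simp add: psub_pCons h_uminus h_one)
  ultimately show ?case unfolding q psub_mult by simp
qed

text \<open>\<open>subst_fract\<close> reads the normalised fraction. Independence of the
  representative is what makes it a field homomorphism, since sums and products are formed with
  unreduced fractions.\<close>

lemma fsub_divide: "q \<noteq> 0 \<Longrightarrow> fsub (to_fract p / to_fract q) = psub p / psub q"
proof -
  assume q: "q \<noteq> 0"
  define f where "f = to_fract p / to_fract q"
  obtain p' q' where pq: "quot_of_fract f = (p', q')" by fastforce
  have q': "q' \<noteq> 0" by (metis pq snd_conv snd_quot_of_fract_nonzero)
  have "to_fract p / to_fract q = to_fract p' / to_fract q'"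
    using Fract_quot_of_fract[of f] unfolding Fract_conv_to_fract pq by (simp add: f_def)
  then have "to_fract (p * q') = to_fract (p' * q)"
    using q q' by (simp add: divide_simps)
  then have "psub p * psub q' = psub p' * psub q"
    unfolding to_fract_eq_iff psub_mult[symmetric] by simp
  then have "psub p / psub q = psub p' / psub q'"
    using psub_nonzero[OF q] psub_nonzero[OF q'] by (simp add: divide_simps)
  moreover have "fsub f = psub p' / psub q'"
    by (simp add: subst_fract_def pq psub_def)
  ultimately show ?thesis by (simp add: f_def)
qed

lemma fsub_to_fract: "fsub (to_fract p) = psub p"
  using fsub_divide[of 1 p] by simp

lemma fsub_add: "fsub (f + g) = fsub f + fsub g"
proof -
  obtain p q where q: "q \<noteq> 0" "f = to_fract p / to_fract q"
    by (rule mero_cases)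
  obtain p' q' where q': "q' \<noteq> 0" "g = to_fract p' / to_fract q'"
    by (rule mero_cases)
  have "f + g = to_fract (p * q' + p' * q) / to_fract (q * q')"
    using q q' by (simp add: add_frac_eq)
  moreover have "q * q' \<noteq> 0" using q q' by simp
  ultimately show ?thesis
    using q q' psub_nonzero[of q] psub_nonzero[of q']
    by (simp only: fsub_divide psub_add psub_mult add_frac_eq not_False_eq_True simp_thms)
qed

lemma fsub_mult: "fsub (f * g) = fsub f * fsub g"
proof -
  obtain p q where q: "q \<noteq> 0" "f = to_fract p / to_fract q"
    by (rule mero_cases)
  obtain p' q' where q': "q' \<noteq> 0" "g = to_fract p' / to_fract q'"
    by (rule mero_cases)
  have "f * g = to_fract (p * p') / to_fract (q * q')"
    using q q' by simp
  with q q' show ?thesis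
    by (simp add: fsub_divide psub_mult del: to_fract_mult)
qed

lemma fsub_0 [simp]: "fsub 0 = 0"
  using fsub_to_fract[of 0] by simp

lemma fsub_1 [simp]: "fsub 1 = 1"
  using fsub_to_fract[of 1] by simp

lemma fsub_eq_0_iff: "fsub f = 0 \<longleftrightarrow> f = 0"
proof
  assume "fsub f = 0"
  show "f = 0"
  proof (rule ccontr)
    assume "f \<noteq> 0"
    then have "fsub f * fsub (inverse f) = 1" by (simp flip: fsub_mult)
    with \<open>fsub f = 0\<close> show False by simp
  qed
qed simp

lemma fsub_uminus: "fsub (- f) = - fsub f"
  using fsub_add[of f "- f"] by (simp add: eq_neg_iff_add_eq_0 add.commute)

lemma fsub_diff: "fsub (f - g) = fsub f - fsub g"
  using fsub_add[of f "- g"] by (simp add: fsub_uminus)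

lemma fsub_divide': "fsub (f / g) = fsub f / fsub g"
proof (cases "g = 0")
  case False
  then have "fsub (f / g) * fsub g = fsub f" by (simp flip: fsub_mult)
  then show ?thesis using False by (simp add: fsub_eq_0_iff divide_simps)
qed simp

lemma fsub_power: "fsub (f ^ n) = fsub f ^ n"
  by (induction n) (simp_all add: fsub_mult)

lemma fsub_eq_iff: "fsub f = fsub g \<longleftrightarrow> f = g"
  using fsub_eq_0_iff[of "f - g"] by (simp add: fsub_diff)

lemma fsub_cst: "fsub (cst c) = h c"
  by (simp add: fsub_to_fract psub_pCons)

lemma fsub_ref_coord: "fsub ref_coord = y"
  by (simp add: ref_coord_def fsub_to_fract psub_pCons h_zero h_one)

end

lemma subst_hom_fls_Fin: "subst_hom fls_const (fls_const a + fls_X :: complex fls)"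
proof
  fix c :: complex
  have "fls_nth (fls_const a + fls_X) 1 \<noteq> fls_nth (fls_const c) 1" by simp
  then show "fls_const a + fls_X \<noteq> fls_const c" by metis
qed (simp_all add: fls_plus_const fls_const_mult_const)

lemma subst_hom_fls_Infty: "subst_hom fls_const (fls_X_inv :: complex fls)"
proof
  fix c :: complex
  have "fls_nth fls_X_inv (- 1) \<noteq> fls_nth (fls_const c) (- 1)" by simp
  then show "fls_X_inv \<noteq> fls_const c" by metis
qed (simp_all add: fls_plus_const fls_const_mult_const)

fun expand_param :: "proj_line \<Rightarrow> complex fls" where
  "expand_param (Fin a) = fls_const a + fls_X"
| "expand_param Infty = fls_X_inv"

lemma expand_eq: "expand z f = subst_fract fls_const f (expand_param z)"
  by (cases z) simp_all

lemma subst_hom_expand: "subst_hom fls_const (expand_param z)"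
  by (cases z) (simp_all add: subst_hom_fls_Fin subst_hom_fls_Infty)

lemma subst_hom_aux: "subst_hom aux_const (aux_point j)"
proof
  fix c
  have "Poly_Mapping.single (Poly_Mapping.single j (1::nat)) (1::complex) \<noteq> Poly_Mapping.single 0 c"
  proof
    assume *: "Poly_Mapping.single (Poly_Mapping.single j (1::nat)) (1::complex) = Poly_Mapping.single 0 c"
    have "Poly_Mapping.single j (1::nat) \<noteq> 0"
      by (metis lookup_single_eq lookup_zero zero_neq_one)
    then show False
      using arg_cong[OF *, of "\<lambda>m. Poly_Mapping.lookup m (Poly_Mapping.single j 1)"]
      by (simp add: lookup_single_not_eq)
  qed
  then show "aux_point j \<noteq> aux_const c"
    by (simp add: aux_point_def aux_const_def)
qed (simp_all add: aux_const_def single_add mult_single flip: to_fract_add to_fract_mult)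

section \<open>Homomorphisms out of the symmetric algebra\<close>

lemma scalar_add: "scalar (a + b) = scalar a + scalar b"
  by transfer (simp add: free_const_def single_add sym_rel_def sym_ideal.zero)

lemma scalar_mult: "scalar (a * b) = scalar a * scalar b"
  by transfer (simp add: free_const_def mult_single sym_rel_def sym_ideal.zero)

lemma scalar_1 [simp]: "scalar 1 = 1"
  by transfer (simp add: free_const_def sym_rel_def sym_ideal.zero)

lemma scalar_0 [simp]: "scalar 0 = 0"
  by transfer (simp add: free_const_def sym_rel_def sym_ideal.zero)

lemma scalar_numeral: "scalar (numeral n) = numeral n"
proof -
  have "scalar (of_nat k) = of_nat k" for k
    by (induction k) (simp_all add: scalar_add)
  from this[of "numeral n"] show ?thesis by simp
qed

lemma gen_add: "Rep_kform \<gamma> = Rep_kform \<alpha> + Rep_kform \<beta> \<Longrightarrow> gen \<gamma> = gen \<alpha> + gen \<beta>"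
  using sym_ideal.add_rel[of \<gamma> \<alpha> \<beta> 1]
  by (simp add: gen.abs_eq plus_sym.abs_eq sym.abs_eq_iff sym_rel_def)

lemma gen_scale: "Rep_kform \<gamma> = cst c * Rep_kform \<alpha> \<Longrightarrow> gen \<gamma> = scalar c * gen \<alpha>"
  using sym_ideal.scale_rel[of \<gamma> c \<alpha> 1]
  by (simp add: gen.abs_eq scalar.abs_eq times_sym.abs_eq sym.abs_eq_iff sym_rel_def)

lemma abs_sym_cases [cases type: sym]:
  obtains p where "v = abs_sym p"
  using Quotient_abs_rep[OF Quotient_sym, of v, symmetric] that by blast

lemma poly_mapping_single_induct [case_names single add]:
  assumes "\<And>k c. P (Poly_Mapping.single k c)"
    and "\<And>p q. P p \<Longrightarrow> P q \<Longrightarrow> P (p + q)"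
  shows "P (p :: 'a \<Rightarrow>\<^sub>0 'b::comm_monoid_add)"
proof -
  have "P (\<Sum>k\<in>K. Poly_Mapping.single k (Poly_Mapping.lookup p k))" if "finite K" for K
    using that
  proof induction
    case empty
    \<comment> \<open>The zero mapping is itself a single term with coefficient 0.\<close>
    show ?case using assms(1)[of undefined 0] by simp
  qed (simp add: assms)
  from this[OF finite_keys[of p]] show ?thesis
  proof (rule back_subst[of P])
    show "(\<Sum>k\<in>Poly_Mapping.keys p. Poly_Mapping.single k (Poly_Mapping.lookup p k)) = p"
      by (rule poly_mapping_eqI)
        (simp add: lookup_sum lookup_single when_def sum.delta in_keys_iff)
  qed
qed

lemma free_monomial:
  "\<exists>\<alpha>s. Poly_Mapping.single k (1::complex) = (\<Prod>\<alpha>\<leftarrow>\<alpha>s. free_gen \<alpha>)"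
proof (induction k rule: poly_mapping_single_induct)
  case (single \<alpha> n)
  have "Poly_Mapping.single (Poly_Mapping.single \<alpha> n) (1::complex)
      = (\<Prod>\<alpha>\<leftarrow>replicate n \<alpha>. free_gen \<alpha>)"
  proof (induction n)
    case (Suc n)
    have "Poly_Mapping.single \<alpha> (Suc n) = Poly_Mapping.single \<alpha> 1 + Poly_Mapping.single \<alpha> n"
      by (simp flip: single_add)
    then have "Poly_Mapping.single (Poly_Mapping.single \<alpha> (Suc n)) 1
        = free_gen \<alpha> * Poly_Mapping.single (Poly_Mapping.single \<alpha> n) 1"
      by (simp only: free_gen_def mult_single mult_1)
    then show ?case unfolding Suc by simp
  qed simp
  then show ?case by blast
next
  case (add k l)
  then obtain \<alpha>s \<beta>s where *:
    "Poly_Mapping.single k (1::complex) = (\<Prod>\<alpha>\<leftarrow>\<alpha>s. free_gen \<alpha>)"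
    "Poly_Mapping.single l (1::complex) = (\<Prod>\<alpha>\<leftarrow>\<beta>s. free_gen \<alpha>)"
    by blast
  have "Poly_Mapping.single (k + l) (1::complex)
      = Poly_Mapping.single k 1 * Poly_Mapping.single l 1"
    by (simp only: mult_single mult_1)
  then have "Poly_Mapping.single (k + l) (1::complex) = (\<Prod>\<alpha>\<leftarrow>\<alpha>s @ \<beta>s. free_gen \<alpha>)"
    by (simp only: * map_append prod_list.append)
  then show ?case by blast
qed

lemma abs_sym_prod_list: "abs_sym (\<Prod>\<alpha>\<leftarrow>\<alpha>s. free_gen \<alpha>) = (\<Prod>\<alpha>\<leftarrow>\<alpha>s. gen \<alpha>)"
  by (induction \<alpha>s) (simp_all add: one_sym.abs_eq gen.abs_eq flip: times_sym.abs_eq)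

lemma sym_induct [case_names monomial add]:
  assumes monomial: "\<And>c \<alpha>s. P (scalar c * (\<Prod>\<alpha>\<leftarrow>\<alpha>s. gen \<alpha>))"
    and add: "\<And>v w. P v \<Longrightarrow> P w \<Longrightarrow> P (v + w)"
  shows "P v"
proof -
  have "P (abs_sym p)" for p
  proof (induction p rule: poly_mapping_single_induct)
    case (single k c)
    obtain \<alpha>s where "Poly_Mapping.single k (1::complex) = (\<Prod>\<alpha>\<leftarrow>\<alpha>s. free_gen \<alpha>)"
      using free_monomial by blast
    moreover have "Poly_Mapping.single k c = free_const c * Poly_Mapping.single k 1"
      by (simp add: free_const_def mult_single)
    ultimately show ?case
      using monomial[of c \<alpha>s]
      by (simp add: scalar.abs_eq flip: times_sym.abs_eq abs_sym_prod_list)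
  next
    case (add p q)
    then show ?case using assms(2) by (simp flip: plus_sym.abs_eq)
  qed
  then show ?thesis by (cases v) simp
qed

text \<open>The universal property of the symmetric algebra: linear data on the generators extend to
  an algebra homomorphism. It serves twice, with target polynomials in \<epsilon> over
  \<open>sym\<close> (derivations) and polynomials over \<open>aux_fun\<close> (components).\<close>

locale sym_lift =
  fixes emb :: "complex \<Rightarrow> 'r::comm_ring_1" and \<phi> :: "kform \<Rightarrow> 'r"
  assumes emb_add: "emb (a + b) = emb a + emb b"
    and emb_mult: "emb (a * b) = emb a * emb b"
    and emb_one: "emb 1 = 1"
    and phi_add: "Rep_kform \<gamma> = Rep_kform \<alpha> + Rep_kform \<beta> \<Longrightarrow> \<phi> \<gamma> = \<phi> \<alpha> + \<phi> \<beta>"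
    and phi_scale: "Rep_kform \<gamma> = cst c * Rep_kform \<alpha> \<Longrightarrow> \<phi> \<gamma> = emb c * \<phi> \<alpha>"
begin

lemma emb_zero: "emb 0 = 0"
  using emb_add[of 0 0] by (metis add_0 add_cancel_right_left)

definition monomial_value :: "(kform \<Rightarrow>\<^sub>0 nat) \<Rightarrow> 'r" where
  "monomial_value k = Prod_any (\<lambda>\<alpha>. \<phi> \<alpha> ^ Poly_Mapping.lookup k \<alpha>)"

definition free_lift :: "free_alg \<Rightarrow> 'r" where
  "free_lift p = Sum_any (\<lambda>k. emb (Poly_Mapping.lookup p k) * monomial_value k)"

lemma monomial_value_0 [simp]: "monomial_value 0 = 1"
  by (simp add: monomial_value_def)

lemma monomial_value_gen: "monomial_value (Poly_Mapping.single \<alpha> 1) = \<phi> \<alpha>"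
proof -
  have "(\<lambda>\<beta>. \<phi> \<beta> ^ Poly_Mapping.lookup (Poly_Mapping.single \<alpha> 1) \<beta>)
      = (\<lambda>\<beta>. if \<beta> = \<alpha> then \<phi> \<beta> else 1)"
    by (auto simp: lookup_single)
  then show ?thesis unfolding monomial_value_def by (simp only: Prod_any.delta)
qed

lemma monomial_value_add: "monomial_value (k + l) = monomial_value k * monomial_value l"
proof -
  have fin: "finite {\<alpha>. \<phi> \<alpha> ^ Poly_Mapping.lookup m \<alpha> \<noteq> 1}" for m
    by (rule finite_subset[OF _ finite_keys[of m]]) (auto simp: in_keys_iff intro: ccontr)
  show ?thesis
    unfolding monomial_value_def lookup_add power_add by (rule Prod_any.distrib[OF fin fin])
qed

lemma free_lift_add: "free_lift (p + q) = free_lift p + free_lift q"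
proof -
  have fin: "finite {k. emb (Poly_Mapping.lookup r k) * monomial_value k \<noteq> 0}" for r
    by (rule finite_subset[OF _ finite_keys[of r]]) (auto simp: in_keys_iff emb_zero intro: ccontr)
  show ?thesis
    unfolding free_lift_def lookup_add emb_add distrib_right by (rule Sum_any.distrib[OF fin fin])
qed

lemma free_lift_single: "free_lift (Poly_Mapping.single k c) = emb c * monomial_value k"
proof -
  have "(\<lambda>l. emb (Poly_Mapping.lookup (Poly_Mapping.single k c) l) * monomial_value l)
      = (\<lambda>l. if l = k then emb c * monomial_value l else 0)"
    by (auto simp: lookup_single emb_zero)
  then show ?thesis unfolding free_lift_def by (simp only: Sum_any.delta)
qed

lemma free_lift_mult: "free_lift (p * q) = free_lift p * free_lift q"
proof (induction p rule: poly_mapping_single_induct)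
  case (single k c)
  show ?case
    by (induction q rule: poly_mapping_single_induct)
      (simp_all add: mult_single free_lift_single free_lift_add monomial_value_add emb_mult
        algebra_simps)
qed (simp add: free_lift_add algebra_simps)

lemma free_lift_gen: "free_lift (free_gen \<alpha>) = \<phi> \<alpha>"
  unfolding free_gen_def free_lift_single monomial_value_gen by (simp add: emb_one)

lemma free_lift_const: "free_lift (free_const c) = emb c"
  by (simp add: free_const_def free_lift_single)

lemma free_lift_diff: "free_lift (p - q) = free_lift p - free_lift q"
  using free_lift_add[of "p - q" q] by (simp add: algebra_simps)

lemma free_lift_ideal: "p \<in> sym_ideal \<Longrightarrow> free_lift p = 0"
proof (induction rule: sym_ideal.induct)
  case zero
  show ?case using free_lift_const[of 0] by (simp add: free_const_def emb_zero)
next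
  case (add_rel \<gamma> \<alpha> \<beta> p)
  then show ?case
    by (simp add: free_lift_mult free_lift_diff free_lift_add free_lift_gen phi_add)
next
  case (scale_rel \<gamma> c \<alpha> p)
  then show ?case
    by (simp add: free_lift_mult free_lift_diff free_lift_gen free_lift_const phi_scale)
qed (simp add: free_lift_add)

definition lift :: "sym \<Rightarrow> 'r" where
  "lift v = free_lift (rep_sym v)"

text \<open>Well-definedness: two representatives differ by an element of \<open>sym_ideal\<close>,
  on whose generators \<open>free_lift\<close> vanishes by linearity of \<phi>.\<close>

lemma lift_abs_sym: "lift (abs_sym p) = free_lift p"
proof -
  have "sym_rel (rep_sym (abs_sym p)) p"
    unfolding sym.abs_eq_iff[symmetric] by (rule Quotient_abs_rep[OF Quotient_sym])
  then have "free_lift (rep_sym (abs_sym p) - p) = 0"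
    unfolding sym_rel_def by (rule free_lift_ideal)
  then show ?thesis by (simp add: lift_def free_lift_diff)
qed

lemma lift_add: "lift (v + w) = lift v + lift w"
proof (cases v, cases w)
  fix p q assume "v = abs_sym p" "w = abs_sym q"
  then show ?thesis by (simp add: plus_sym.abs_eq lift_abs_sym free_lift_add)
qed

lemma lift_mult: "lift (v * w) = lift v * lift w"
proof (cases v, cases w)
  fix p q assume "v = abs_sym p" "w = abs_sym q"
  then show ?thesis by (simp add: times_sym.abs_eq lift_abs_sym free_lift_mult)
qed

lemma lift_scalar: "lift (scalar c) = emb c"
  by (simp add: scalar.abs_eq lift_abs_sym free_lift_const)

lemma lift_gen: "lift (gen \<alpha>) = \<phi> \<alpha>"
  by (simp add: gen.abs_eq lift_abs_sym free_lift_gen)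

lemma lift_prod_list: "lift (\<Prod>\<alpha>\<leftarrow>\<alpha>s. gen \<alpha>) = (\<Prod>\<alpha>\<leftarrow>\<alpha>s. \<phi> \<alpha>)"
  using lift_scalar[of 1] by (induction \<alpha>s) (simp_all add: lift_mult lift_gen emb_one)

end

section \<open>Derivations of the symmetric algebra\<close>

text \<open>\<open>kform\<close> carries no vector space operations; linearity is therefore phrased
  through \<open>Rep_kform\<close>, in the same shape as the relations generating
  \<open>sym_ideal\<close>.\<close>

definition linear_functional :: "(kform \<Rightarrow> complex) \<Rightarrow> bool" where
  "linear_functional \<phi> \<longleftrightarrow>
     (\<forall>\<alpha> \<beta> \<gamma>. Rep_kform \<gamma> = Rep_kform \<alpha> + Rep_kform \<beta> \<longrightarrow> \<phi> \<gamma> = \<phi> \<alpha> + \<phi> \<beta>) \<and>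
     (\<forall>\<alpha> \<gamma> c. Rep_kform \<gamma> = cst c * Rep_kform \<alpha> \<longrightarrow> \<phi> \<gamma> = c * \<phi> \<alpha>)"

text \<open>The derivation is read off from the first order part of the homomorphism
  \<open>\<alpha> \<mapsto> \<alpha> + \<phi>(\<alpha>) \<epsilon>\<close> into polynomials in \<open>\<epsilon>\<close>.\<close>

definition sym_derivation :: "(kform \<Rightarrow> complex) \<Rightarrow> sym \<Rightarrow> sym" where
  "sym_derivation \<phi> v =
     coeff (sym_lift.lift (\<lambda>c. [:scalar c:]) (\<lambda>\<alpha>. [:gen \<alpha>, scalar (\<phi> \<alpha>):]) v) 1"

lemma sym_lift_dual:
  "linear_functional \<phi> \<Longrightarrow> sym_lift (\<lambda>c. [:scalar c:]) (\<lambda>\<alpha>. [:gen \<alpha>, scalar (\<phi> \<alpha>):])"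
  unfolding linear_functional_def
  by unfold_locales (simp_all add: scalar_add scalar_mult gen_add gen_scale one_pCons)

context
  fixes \<phi> assumes lin: "linear_functional \<phi>"
begin

interpretation dual: sym_lift "\<lambda>c. [:scalar c:]" "\<lambda>\<alpha>. [:gen \<alpha>, scalar (\<phi> \<alpha>):]"
  by (rule sym_lift_dual[OF lin])

text \<open>Modulo \<epsilon> the homomorphism is the identity. Multiplicativity then gives the
  Leibniz rule in the coefficient of \<epsilon>; higher powers of \<epsilon> are simply not looked
  at.\<close>

lemma dual_coeff_0: "coeff (dual.lift v) 0 = v"
proof (induction v rule: sym_induct)
  case (monomial c \<alpha>s)
  have "coeff (dual.lift (\<Prod>\<alpha>\<leftarrow>\<alpha>s. gen \<alpha>)) 0 = (\<Prod>\<alpha>\<leftarrow>\<alpha>s. gen \<alpha>)"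
    unfolding dual.lift_prod_list by (induction \<alpha>s) (simp_all add: coeff_mult_0)
  then show ?case by (simp only: dual.lift_mult dual.lift_scalar coeff_mult_0 coeff_pCons_0)
next
  case (add v w)
  then show ?case by (simp only: dual.lift_add coeff_add)
qed

lemma sym_derivation_add: "sym_derivation \<phi> (v + w) = sym_derivation \<phi> v + sym_derivation \<phi> w"
  by (simp add: sym_derivation_def dual.lift_add)

lemma sym_derivation_mult:
  "sym_derivation \<phi> (v * w) = sym_derivation \<phi> v * w + v * sym_derivation \<phi> w"
  using dual_coeff_0[of v] dual_coeff_0[of w]
  by (simp add: sym_derivation_def dual.lift_mult coeff_mult add.commute)

lemma sym_derivation_scalar: "sym_derivation \<phi> (scalar c) = 0"
  by (simp add: sym_derivation_def dual.lift_scalar)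

lemma sym_derivation_gen: "sym_derivation \<phi> (gen \<alpha>) = scalar (\<phi> \<alpha>)"
  by (simp add: sym_derivation_def dual.lift_gen)

end

section \<open>Components and Ryser's formula\<close>

text \<open>Expand the product of 1 + f j over J, where f is 0 on T and -1 elsewhere: a subset S
  contributes only if J - S misses T, and the product vanishes as soon as J is not contained in
  T.\<close>

lemma alternating_superset_sum:
  assumes "finite J" and "T \<subseteq> J"
  shows "(\<Sum>S\<in>Pow J. if T \<subseteq> S then (- 1) ^ (card J - card S) else 0)
    = (if J \<subseteq> T then 1 else (0 :: 'r::comm_ring_1))"
proof -
  define f :: "'a \<Rightarrow> 'r" where "f j = (if j \<in> T then 0 else - 1)" for j
  have "(\<Sum>S\<in>Pow J. if T \<subseteq> S then (- 1) ^ (card J - card S) else 0)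
      = (\<Sum>S\<in>Pow J. (\<Prod>j\<in>S. 1) * (\<Prod>j\<in>J - S. f j))"
  proof (rule sum.cong[OF refl])
    fix S assume S: "S \<in> Pow J"
    then have "finite S" using assms finite_subset by blast
    show "(if T \<subseteq> S then (- 1) ^ (card J - card S) else 0) = (\<Prod>j\<in>S. 1) * (\<Prod>j\<in>J - S. f j)"
    proof (cases "T \<subseteq> S")
      case True
      then have "(\<Prod>j\<in>J - S. f j) = (\<Prod>j\<in>J - S. - 1)"
        by (intro prod.cong) (auto simp: f_def)
      then show ?thesis using True S \<open>finite S\<close> by (simp add: card_Diff_subset)
    next
      case False
      then obtain j where "j \<in> T" "j \<in> J - S" using \<open>T \<subseteq> J\<close> by blast
      then have "(\<Prod>j\<in>J - S. f j) = 0"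
        using assms by (intro prod_zero) (auto simp: f_def)
      then show ?thesis using False by simp
    qed
  qed
  also have "\<dots> = (\<Prod>j\<in>J. 1 + f j)"
    using prod_add[OF assms(1), of "\<lambda>_. 1" f] by simp
  also have "\<dots> = (if J \<subseteq> T then 1 else 0)"
  proof (cases "J \<subseteq> T")
    case True
    then show ?thesis by (auto simp: f_def intro!: prod.neutral)
  next
    case False
    then show ?thesis using assms by (auto simp: f_def intro!: prod_zero)
  qed
  finally show ?thesis .
qed

text \<open>Expanding the product of row sums gives a sum over maps g into S. After exchanging the
  sums, inclusion-exclusion over S keeps only the surjective g, which on a finite set are the
  permutations.\<close>

lemma permanent_ryser:
  fixes a :: "nat \<Rightarrow> nat \<Rightarrow> 'r::comm_ring_1"
  shows "(\<Sum>\<sigma> | \<sigma> permutes {..<m}. \<Prod>j<m. a (\<sigma> j) j)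
    = (\<Sum>S\<in>Pow {..<m}. (- 1) ^ (m - card S) * (\<Prod>i<m. \<Sum>j\<in>S. a i j))"
proof -
  define I where "I = {..<m}"
  have [simp]: "finite I" "card I = m" by (simp_all add: I_def)
  define A where "A g = (\<Prod>i\<in>I. a i (g i))" for g
  have "(\<Sum>S\<in>Pow I. (- 1) ^ (m - card S) * (\<Prod>i\<in>I. \<Sum>j\<in>S. a i j))
      = (\<Sum>S\<in>Pow I. \<Sum>g\<in>I \<rightarrow>\<^sub>E I. A g * (if g ` I \<subseteq> S then (- 1) ^ (card I - card S) else 0))"
  proof (rule sum.cong[OF refl])
    fix S assume S: "S \<in> Pow I"
    then have "finite S" using finite_subset[OF _ \<open>finite I\<close>] by auto
    then have "(\<Prod>i\<in>I. \<Sum>j\<in>S. a i j) = (\<Sum>g\<in>I \<rightarrow>\<^sub>E S. A g)"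
      unfolding A_def by (intro prod_sum_PiE) auto
    also have "\<dots> = (\<Sum>g\<in>I \<rightarrow>\<^sub>E I. if g ` I \<subseteq> S then A g else 0)"
      using S by (intro sum.mono_neutral_cong_left) (auto simp: finite_PiE PiE_iff)
    finally show "(- 1) ^ (m - card S) * (\<Prod>i\<in>I. \<Sum>j\<in>S. a i j)
        = (\<Sum>g\<in>I \<rightarrow>\<^sub>E I. A g * (if g ` I \<subseteq> S then (- 1) ^ (card I - card S) else 0))"
      by (auto simp: sum_distrib_left intro!: sum.cong)
  qed
  also have "\<dots> = (\<Sum>g\<in>I \<rightarrow>\<^sub>E I. A g *
      (\<Sum>S\<in>Pow I. if g ` I \<subseteq> S then (- 1) ^ (card I - card S) else 0))"
    by (subst sum.swap) (simp only: sum_distrib_left)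
  also have "\<dots> = (\<Sum>g\<in>I \<rightarrow>\<^sub>E I. A g * (if I \<subseteq> g ` I then 1 else 0))"
  proof (rule sum.cong[OF refl])
    fix g assume "g \<in> I \<rightarrow>\<^sub>E I"
    then have "g ` I \<subseteq> I" by auto
    then show "A g * (\<Sum>S\<in>Pow I. if g ` I \<subseteq> S then (- 1) ^ (card I - card S) else 0)
        = A g * (if I \<subseteq> g ` I then 1 else 0)"
      by (simp only: alternating_superset_sum[OF \<open>finite I\<close>])
  qed
  also have "\<dots> = (\<Sum>g | g \<in> I \<rightarrow>\<^sub>E I \<and> I \<subseteq> g ` I. A g)"
    by (intro sum.mono_neutral_cong_right) (auto simp: finite_PiE)
  also have "\<dots> = (\<Sum>\<sigma> | \<sigma> permutes I. A \<sigma>)"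
  \<comment> \<open>The two conventions outside I differ: members of \<open>PiE\<close> are
    \<open>undefined\<close> there, permutations are the identity.\<close>
  proof (rule sum.reindex_bij_witness[where j = "\<lambda>g i. if i \<in> I then g i else i"
        and i = "\<lambda>\<sigma>. restrict \<sigma> I"])
    fix g assume g: "g \<in> {g. g \<in> I \<rightarrow>\<^sub>E I \<and> I \<subseteq> g ` I}"
    then show "(\<lambda>i\<in>I. if i \<in> I then g i else i) = g"
      by (auto simp: fun_eq_iff PiE_def extensional_def restrict_def)
    have "g ` I = I" using g by auto
    then have "bij_betw g I I"
      using \<open>finite I\<close> by (simp add: bij_betw_def eq_card_imp_inj_on)
    then have "bij_betw (\<lambda>i. if i \<in> I then g i else i) I I"
      by (simp cong: bij_betw_cong)
    then show "(\<lambda>i. if i \<in> I then g i else i) \<in> {\<sigma>. \<sigma> permutes I}"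
      by (simp add: bij_imp_permutes)
    show "A (\<lambda>i. if i \<in> I then g i else i) = A g"
      by (simp add: A_def)
  next
    fix \<sigma> assume "\<sigma> \<in> {\<sigma>. \<sigma> permutes I}"
    then have \<sigma>: "\<sigma> permutes I" by simp
    then show "(\<lambda>i. if i \<in> I then restrict \<sigma> I i else i) = \<sigma>"
      by (auto simp: fun_eq_iff permutes_def)
    show "restrict \<sigma> I \<in> {g. g \<in> I \<rightarrow>\<^sub>E I \<and> I \<subseteq> g ` I}"
      using permutes_image[OF \<sigma>] by auto
  qed
  \<comment> \<open>The expansion assigns a point to each form, whereas \<open>is_component\<close>
    assigns a form to each point.\<close>
  also have "\<dots> = (\<Sum>\<sigma> | \<sigma> permutes I. A (inv \<sigma>))"
    by (rule sum_permutations_inverse)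
  also have "\<dots> = (\<Sum>\<sigma> | \<sigma> permutes I. \<Prod>j\<in>I. a (\<sigma> j) j)"
  proof (rule sum.cong[OF refl])
    fix \<sigma> assume "\<sigma> \<in> {\<sigma>. \<sigma> permutes I}"
    then have \<sigma>: "\<sigma> permutes I" by simp
    show "A (inv \<sigma>) = (\<Prod>j\<in>I. a (\<sigma> j) j)"
      unfolding A_def
      by (subst prod.permute[OF \<sigma>]) (simp add: o_def permutes_inverses(2)[OF \<sigma>])
  qed
  finally show ?thesis by (simp add: I_def)
qed

lemma aux_const_simps:
  "aux_const (a + b) = aux_const a + aux_const b" "aux_const (a * b) = aux_const a * aux_const b"
  "aux_const 1 = 1" "aux_const 0 = 0" "aux_const (- a) = - aux_const a"
  by (fact subst_hom.h_add[OF subst_hom_aux] subst_hom.h_mult[OF subst_hom_aux]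
    subst_hom.h_one[OF subst_hom_aux] subst_hom.h_zero[OF subst_hom_aux]
    subst_hom.h_uminus[OF subst_hom_aux])+

lemma aux_const_diff: "aux_const (a - b) = aux_const a - aux_const b"
  using aux_const_simps(1)[of a "- b"] by (simp add: aux_const_simps)

lemma aux_const_eq_iff: "aux_const a = aux_const b \<longleftrightarrow> a = b"
  using subst_hom.h_eq_0_iff[OF subst_hom_aux, of "a - b"] by (simp add: aux_const_diff)

text \<open>Specialising all forms to the sum of their values at the points \<open>t\<^sub>j\<close>, \<open>j \<in> S\<close>, with an
  additional variable recording the degree.\<close>

definition point_lift :: "nat set \<Rightarrow> sym \<Rightarrow> aux_fun poly" where
  "point_lift S = sym_lift.lift (\<lambda>c. [:aux_const c:]) (\<lambda>\<alpha>. [:0, \<Sum>j\<in>S. form_at_aux \<alpha> j:])"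

lemma sym_lift_point: "sym_lift (\<lambda>c. [:aux_const c:]) (\<lambda>\<alpha>. [:0, \<Sum>j\<in>S. form_at_aux \<alpha> j:])"
proof
  fix \<alpha> \<beta> \<gamma> c
  show "[:0, \<Sum>j\<in>S. form_at_aux \<gamma> j:]
      = [:0, \<Sum>j\<in>S. form_at_aux \<alpha> j:] + [:0, \<Sum>j\<in>S. form_at_aux \<beta> j:]"
    if "Rep_kform \<gamma> = Rep_kform \<alpha> + Rep_kform \<beta>"
    by (simp add: form_at_aux_def that subst_hom.fsub_add[OF subst_hom_aux] sum.distrib)
  show "[:0, \<Sum>j\<in>S. form_at_aux \<gamma> j:] = [:aux_const c:] * [:0, \<Sum>j\<in>S. form_at_aux \<alpha> j:]"
    if "Rep_kform \<gamma> = cst c * Rep_kform \<alpha>"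
    by (simp add: form_at_aux_def that subst_hom.fsub_mult[OF subst_hom_aux]
        subst_hom.fsub_cst[OF subst_hom_aux] flip: sum_distrib_left)
qed (simp_all add: aux_const_simps one_pCons)

lemmas point_lift_add = sym_lift.lift_add[OF sym_lift_point, folded point_lift_def]
  and point_lift_mult = sym_lift.lift_mult[OF sym_lift_point, folded point_lift_def]
  and point_lift_scalar = sym_lift.lift_scalar[OF sym_lift_point, folded point_lift_def]
  and point_lift_gen = sym_lift.lift_gen[OF sym_lift_point, folded point_lift_def]
  and point_lift_prod_list = sym_lift.lift_prod_list[OF sym_lift_point, folded point_lift_def]

text \<open>The explicit candidate for \<open>component\<close>. Symmetrised products are not
  multiplicative in the factors, but each \<open>point_lift S\<close> is, and the coefficient of
  degree m isolates products of m forms.\<close>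

definition ryser_component :: "nat \<Rightarrow> sym \<Rightarrow> aux_fun" where
  "ryser_component m v =
     (\<Sum>S\<in>Pow {..<m}. (- 1) ^ (m - card S) * coeff (point_lift S v) m)"

lemma prod_list_monom: "(\<Prod>x\<leftarrow>xs. [:0, f x:]) = monom (\<Prod>x\<leftarrow>xs. f x) (length xs)"
proof (induction xs)
  case (Cons x xs)
  have "[:0, f x:] = monom (f x) 1" by (simp add: monom_Suc monom_0)
  then show ?case using Cons by (simp add: mult_monom)
qed (simp add: one_pCons monom_0)

lemma coeff_point_lift_prod_list:
  "coeff (point_lift S (\<Prod>\<alpha>\<leftarrow>\<alpha>s. gen \<alpha>)) m =
     (if length \<alpha>s = m then \<Prod>i<m. \<Sum>j\<in>S. form_at_aux (\<alpha>s ! i) j else 0)"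
  unfolding point_lift_prod_list prod_list_monom coeff_monom
  by (simp add: prod.list_conv_set_nth lessThan_atLeast0)

lemma ryser_component_prod_list:
  "ryser_component m (\<Prod>\<alpha>\<leftarrow>\<alpha>s. gen \<alpha>) =
     (if length \<alpha>s = m
      then \<Sum>\<sigma> | \<sigma> permutes {..<m}. \<Prod>j<m. form_at_aux (\<alpha>s ! \<sigma> j) j else 0)"
  unfolding ryser_component_def coeff_point_lift_prod_list
    permanent_ryser[of "\<lambda>i j. form_at_aux (\<alpha>s ! i) j"]
  by simp

lemma ryser_component_add:
  "ryser_component m (v + w) = ryser_component m v + ryser_component m w"
  by (simp only: ryser_component_def point_lift_add coeff_add distrib_left sum.distrib)

lemma ryser_component_scalar:
  "ryser_component m (scalar c * v) = aux_const c * ryser_component m v"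
proof -
  have "coeff (point_lift S (scalar c * v)) m = aux_const c * coeff (point_lift S v) m" for S
    unfolding point_lift_mult point_lift_scalar by simp
  then show ?thesis
    by (simp only: ryser_component_def sum_distrib_left mult.left_commute)
qed

lemma is_component_ryser: "is_component m (ryser_component m)"
  by (simp only: is_component_def ryser_component_prod_list ryser_component_add
      ryser_component_scalar simp_thms)

text \<open>The conditions fix the map on scalar multiples of products of generators, and these span
  W additively.\<close>

lemma is_component_unique:
  assumes C: "is_component m C" and C': "is_component m C'"
  shows "C v = C' v"
proof (induction v rule: sym_induct)
  case (monomial c \<alpha>s)
  have *: "D (scalar c * (\<Prod>\<alpha>\<leftarrow>\<alpha>s. gen \<alpha>)) = aux_const c * (if length \<alpha>s = m
        then \<Sum>\<sigma> | \<sigma> permutes {..<m}. \<Prod>j<m. form_at_aux (\<alpha>s ! \<sigma> j) j else 0)"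
    if "is_component m D" for D
    using that unfolding is_component_def by presburger
  show ?case unfolding *[OF C] *[OF C'] ..
next
  case (add v w)
  have *: "D (v + w) = D v + D w" if "is_component m D" for D
    using that unfolding is_component_def by blast
  show ?case unfolding *[OF C] *[OF C'] add ..
qed

lemma component_eq: "component m v = ryser_component m v"
proof -
  have "is_component m (component m)"
    unfolding component_def by (rule someI[of "is_component m", OF is_component_ryser])
  then show ?thesis by (rule is_component_unique[OF _ is_component_ryser])
qed

lemma component_add: "component m (v + w) = component m v + component m w"
  by (simp only: component_eq ryser_component_add)

lemma component_scalar: "component m (scalar c * v) = aux_const c * component m v"
  by (simp only: component_eq ryser_component_scalar)

lemma component_diff: "component m (v - w) = component m v - component m w"
  using component_add[of m "v - w" w] by simp

section \<open>Expansions and differentials\<close>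

lemmas expand_add = subst_hom.fsub_add[OF subst_hom_expand, folded expand_eq]
  and expand_diff = subst_hom.fsub_diff[OF subst_hom_expand, folded expand_eq]
  and expand_mult = subst_hom.fsub_mult[OF subst_hom_expand, folded expand_eq]
  and expand_divide = subst_hom.fsub_divide'[OF subst_hom_expand, folded expand_eq]
  and expand_cst = subst_hom.fsub_cst[OF subst_hom_expand, folded expand_eq]
  and expand_ref_coord = subst_hom.fsub_ref_coord[OF subst_hom_expand, folded expand_eq]
  and expand_eq_0_iff = subst_hom.fsub_eq_0_iff[OF subst_hom_expand, folded expand_eq]
  and expand_eq_iff = subst_hom.fsub_eq_iff[OF subst_hom_expand, folded expand_eq]

lemma expand_0 [simp]: "expand z 0 = 0" and expand_1 [simp]: "expand z 1 = 1"
  using subst_hom.fsub_0[OF subst_hom_expand, folded expand_eq]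
    subst_hom.fsub_1[OF subst_hom_expand, folded expand_eq] by blast+

lemma cst_simps:
  "cst (a + b) = cst a + cst b" "cst (a * b) = cst a * cst b" "cst 1 = 1" "cst 0 = 0"
  "cst (- a) = - cst a"
  by (simp_all add: one_pCons flip: to_fract_add to_fract_mult to_fract_uminus to_fract_1)

lemma to_fract_pCons: "to_fract (pCons c p) = cst c + ref_coord * to_fract p"
proof -
  have "pCons c p = [:c:] + [:0, 1:] * p" by simp
  then show ?thesis unfolding ref_coord_def by (simp only: to_fract_add to_fract_mult)
qed

text \<open>Regularity as membership in the subring of power series: closure under sums and products
  becomes immediate, and the value is the constant term.\<close>

lemma fls_subdegree_nonneg_iff: "fls_subdegree F \<ge> 0 \<longleftrightarrow> (\<exists>G. F = fps_to_fls G)"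
  by (metis fls_regpart_to_fls_trivial fls_subdegree_fls_to_fps_gt0)

lemma regular_at_iff: "regular_at f z \<longleftrightarrow> (\<exists>G. expand z f = fps_to_fls G)"
  by (simp add: regular_at_def fls_subdegree_nonneg_iff)

lemma value_at_eq: "expand z f = fps_to_fls G \<Longrightarrow> value_at f z = fps_nth G 0"
  by (simp add: value_at_def)

lemma value_at_add: "value_at (f + g) z = value_at f z + value_at g z"
  by (simp add: value_at_def expand_add)

lemma value_at_diff: "value_at (f - g) z = value_at f z - value_at g z"
  by (simp add: value_at_def expand_diff)

lemma value_at_cst: "value_at (cst c) z = c"
  by (simp add: value_at_def expand_cst)

lemma value_at_cst_mult: "value_at (cst c * f) z = c * value_at f z"
  by (simp add: value_at_def expand_mult expand_cst)

lemma regular_at_cst: "regular_at (cst c) z"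
  unfolding regular_at_iff expand_cst by (metis fps_const_to_fls)

lemma regular_at_add: "regular_at f z \<Longrightarrow> regular_at g z \<Longrightarrow> regular_at (f + g) z"
  unfolding regular_at_iff expand_add by (metis fps_to_fls_plus)

lemma regular_at_diff: "regular_at f z \<Longrightarrow> regular_at g z \<Longrightarrow> regular_at (f - g) z"
  unfolding regular_at_iff expand_diff by (metis fps_to_fls_minus)

lemma regular_at_mult: "regular_at f z \<Longrightarrow> regular_at g z \<Longrightarrow> regular_at (f * g) z"
  unfolding regular_at_iff expand_mult by (metis fls_times_fps_to_fls)

lemma value_at_mult:
  "regular_at f z \<Longrightarrow> regular_at g z \<Longrightarrow> value_at (f * g) z = value_at f z * value_at g z"
  unfolding regular_at_iff
  by (auto simp: value_at_def expand_mult simp flip: fls_times_fps_to_fls)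

lemma fls_unit_inverse:
  assumes "fps_nth (G :: complex fps) 0 \<noteq> 0"
  shows "inverse (fps_to_fls G) = fps_to_fls (inverse G)"
  by (rule fls_inverse_fps_to_fls) (use assms in \<open>simp add: subdegree_eq_0_iff\<close>)

lemma regular_at_divide:
  assumes "regular_at f z" "regular_at g z" "value_at g z \<noteq> 0"
  shows "regular_at (f / g) z" "value_at (f / g) z = value_at f z / value_at g z"
proof -
  obtain F G where F: "expand z f = fps_to_fls F" and G: "expand z g = fps_to_fls G"
    using assms(1,2) unfolding regular_at_iff by blast
  have "fps_nth G 0 \<noteq> 0" using assms(3) G by (simp add: value_at_eq)
  then have "expand z (f / g) = fps_to_fls (F * inverse G)"
    unfolding expand_divide F G by (simp add: divide_inverse fls_unit_inverse fls_times_fps_to_fls)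
  then show "regular_at (f / g) z" "value_at (f / g) z = value_at f z / value_at g z"
    unfolding regular_at_iff value_at_eq[OF F] value_at_eq[OF G]
    by (auto simp: value_at_eq divide_inverse)
qed

lemma regular_at_ref_coord: "regular_at ref_coord (Fin a)"
  and value_at_ref_coord: "value_at ref_coord (Fin a) = a"
proof -
  have *: "expand (Fin a) ref_coord = fps_to_fls (fps_const a + fps_X)"
    unfolding expand_ref_coord by simp
  show "regular_at ref_coord (Fin a)" unfolding regular_at_iff using * by blast
  show "value_at ref_coord (Fin a) = a" unfolding value_at_eq[OF *] by simp
qed

lemma regular_at_poly: "regular_at (to_fract p) (Fin a)"
  and value_at_poly: "value_at (to_fract p) (Fin a) = poly p a"
proof -
  have "regular_at (to_fract p) (Fin a) \<and> value_at (to_fract p) (Fin a) = poly p a"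
  proof (induction p)
    case 0
    show ?case using regular_at_cst[of 0 "Fin a"] value_at_cst[of 0 "Fin a"]
      by (simp only: pCons_0_0 poly_0)
  next
    case (pCons c p)
    then show ?case
      by (simp add: to_fract_pCons[of c p] regular_at_add regular_at_mult regular_at_cst value_at_mult
          regular_at_ref_coord value_at_ref_coord value_at_add value_at_cst)
  qed
  then show "regular_at (to_fract p) (Fin a)" "value_at (to_fract p) (Fin a) = poly p a"
    by blast+
qed

lemma finite_poles: "finite {z. \<not> regular_at f z}"
proof -
  obtain p q where q: "q \<noteq> 0" and f: "f = to_fract p / to_fract q" by (rule mero_cases)
  have "{z. \<not> regular_at f z} \<subseteq> insert Infty (Fin ` {a. poly q a = 0})"
  proof
    fix z assume z: "z \<in> {z. \<not> regular_at f z}"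
    show "z \<in> insert Infty (Fin ` {a. poly q a = 0})"
    proof (cases z)
      case (Fin a)
      then have "poly q a = 0"
        using z regular_at_divide(1)[of "to_fract p" z "to_fract q"] unfolding f
        by (auto simp: regular_at_poly value_at_poly)
      then show ?thesis using Fin by simp
    qed simp
  qed
  then show ?thesis by (rule finite_subset) (simp add: poly_roots_finite[OF q])
qed

text \<open>A zero of f is a pole of 1 / f, since otherwise their product 1 would have the value
  0.\<close>

lemma finite_zeros:
  assumes "f \<noteq> 0"
  shows "finite {z. regular_at f z \<and> value_at f z = 0}"
proof (rule finite_subset[OF _ finite_poles[of "1 / f"]], rule subsetI)
  fix z assume z: "z \<in> {z. regular_at f z \<and> value_at f z = 0}"
  have "\<not> regular_at (1 / f) z"
  proof
    assume "regular_at (1 / f) z"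
    then have "value_at (1 / f * f) z = 0" using z by (subst value_at_mult) auto
    then show False using assms value_at_cst[of 1 z] by (simp add: cst_simps)
  qed
  then show "z \<in> {z. \<not> regular_at (1 / f) z}" by simp
qed

lemma finite_fibre:
  assumes "f \<noteq> cst c"
  shows "finite {z. regular_at f z \<and> value_at f z = c}"
proof -
  have "finite {z. regular_at (f - cst c) z \<and> value_at (f - cst c) z = 0}"
    by (rule finite_zeros) (use assms in simp)
  then show ?thesis
    by (rule rev_finite_subset)
      (auto intro: regular_at_diff regular_at_cst simp: value_at_diff value_at_cst)
qed

section \<open>Expansion commutes with differentiation; exact forms\<close>

lemma deriv_expand_poly:
  "fls_deriv (expand z (to_fract p)) = expand_form z (to_fract (pderiv p))"
proof (induction p)
  case (pCons c p)
  have "fls_deriv (expand z (to_fract (pCons c p)))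
      = fls_deriv (expand z ref_coord) * expand z (to_fract p)
        + expand z ref_coord * expand_form z (to_fract (pderiv p))"
    unfolding to_fract_pCons[of c p] expand_add expand_mult expand_cst fls_deriv_add fls_deriv_mult pCons
    by simp
  also have "\<dots> = expand_form z (to_fract p + ref_coord * to_fract (pderiv p))"
    by (simp add: expand_form_def expand_add expand_mult algebra_simps)
  also have "to_fract p + ref_coord * to_fract (pderiv p) = to_fract (pderiv (pCons c p))"
    by (simp add: pderiv_pCons to_fract_pCons[of 0 "pderiv p"])
  finally show ?case .
qed (simp add: expand_form_def)

theorem deriv_expand: "fls_deriv (expand z f) = expand_form z (differential f)"
proof -
  obtain p q where pq: "quot_of_fract f = (p, q)" by fastforce
  have q: "q \<noteq> 0" by (metis pq snd_conv snd_quot_of_fract_nonzero)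
  have f: "f = to_fract p / to_fract q"
    using Fract_quot_of_fract[of f] unfolding Fract_conv_to_fract pq by simp
  define F P Q P' Q' X where defs: "F = expand z f" "P = expand z (to_fract p)"
    "Q = expand z (to_fract q)" "P' = expand z (to_fract (pderiv p))"
    "Q' = expand z (to_fract (pderiv q))" "X = fls_deriv (expand z ref_coord)"
  have Q: "Q \<noteq> 0" using q by (simp add: defs expand_eq_0_iff)
  have "f * to_fract q = to_fract p" using q by (simp add: f)
  then have FQ: "F * Q = P" unfolding defs by (simp only: expand_mult[symmetric])
  then have "fls_deriv (F * Q) = fls_deriv P" by simp
  then have "F * (Q' * X) + fls_deriv F * Q = P' * X"
    unfolding defs fls_deriv_mult deriv_expand_poly expand_form_def .
  then have DQ: "fls_deriv F * Q = P' * X - F * (Q' * X)"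
    by (simp add: eq_diff_eq add.commute)
  have "fls_deriv F * Q ^ 2 = fls_deriv F * Q * Q" by (simp only: power2_eq_square mult.assoc)
  also have "\<dots> = (P' * Q - (F * Q) * Q') * X" unfolding DQ by (simp add: algebra_simps)
  finally have "fls_deriv F = (P' * Q - P * Q') * X / Q ^ 2"
    unfolding FQ using Q by (simp only: nonzero_eq_divide_eq power_not_zero not_False_eq_True)
  moreover have "expand_form z (differential f) = (P' * Q - P * Q') / Q ^ 2 * X"
    unfolding differential_def pq prod.case expand_form_def defs
    by (simp only: expand_divide expand_diff expand_mult power2_eq_square
        to_fract_diff to_fract_mult)
  ultimately show ?thesis unfolding defs by (simp only: times_divide_eq_left)
qed

text \<open>At \<open>Fin 0\<close> the expansion of \<open>ref_coord\<close> is the parameter itself, so there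
  \<open>differential\<close> is the derivation \<open>fls_deriv\<close>.\<close>

lemma expand_differential: "expand (Fin 0) (differential f) = fls_deriv (expand (Fin 0) f)"
  unfolding deriv_expand expand_form_def expand_ref_coord by simp

lemma differential_add: "differential (f + g) = differential f + differential g"
  by (rule iffD1[OF expand_eq_iff[of "Fin 0"]])
    (simp only: expand_differential expand_add fls_deriv_add)

lemma differential_mult: "differential (f * g) = differential f * g + f * differential g"
  by (rule iffD1[OF expand_eq_iff[of "Fin 0"]])
    (simp only: expand_differential expand_add expand_mult fls_deriv_mult add.commute)

lemma differential_cst: "differential (cst c) = 0"
  by (rule iffD1[OF expand_eq_iff[of "Fin 0"]])
    (simp only: expand_differential expand_cst fls_deriv_const expand_0)

lemma differential_diff: "differential (f - g) = differential f - differential g"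
  using differential_add[of "f - g" g] by simp

lemma differential_divide:
  assumes "g \<noteq> 0"
  shows "differential (f / g) = (differential f * g - f * differential g) / g ^ 2"
proof -
  have "differential f = differential (f / g) * g + f / g * differential g"
    using differential_mult[of "f / g" g] assms by simp
  then show ?thesis using assms by (simp add: field_simps power2_eq_square)
qed

text \<open>The derivative of a Laurent series has no term of exponent -1. This is how all the forms
  constructed below are placed in K.\<close>

lemma form_residue_differential: "form_residue (differential f) z = 0"
  unfolding form_residue_def by (simp flip: deriv_expand)

lemma Rep_kform_differential: "Rep_kform (Abs_kform (differential f)) = differential f"
  by (rule Abs_kform_inverse) (simp add: form_residue_differential)

text \<open>The form is exact, with primitive 1/(u - u(z)), hence free of residues; only then does
  \<open>Abs_kform\<close> have a known representative.\<close>

lemma Rep_e_form: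
  assumes "u \<noteq> cst (value_at u z)"
  shows "Rep_kform (e_form u z) = - (differential u / (u - cst (value_at u z)) ^ 2)"
proof -
  have "differential (1 / (u - cst (value_at u z)))
      = - (differential u / (u - cst (value_at u z)) ^ 2)"
    using assms differential_cst[of 1]
    by (subst differential_divide) (simp_all add: differential_diff differential_cst cst_simps)
  then show ?thesis using Rep_kform_differential unfolding e_form_def by metis
qed

section \<open>Coordinates\<close>

text \<open>In lowest terms p/q, a root of q would be a root of p as well, because f q = p with f
  regular. So q has no root and is constant.\<close>

lemma regular_at_all_finite:
  assumes "\<And>a. regular_at f (Fin a)"
  obtains p where "f = to_fract p"
proof -
  obtain p q where pq: "quot_of_fract f = (p, q)" by fastforce
  have q: "q \<noteq> 0" by (metis pq snd_conv snd_quot_of_fract_nonzero)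
  have f: "f = to_fract p / to_fract q"
    using Fract_quot_of_fract[of f] unfolding Fract_conv_to_fract pq by simp
  have "coprime p q" using coprime_quot_of_fract[of f] by (simp add: pq)
  have "poly q a \<noteq> 0" for a
  proof
    assume "poly q a = 0"
    have "f * to_fract q = to_fract p" using q by (simp add: f)
    then have "value_at f (Fin a) * poly q a = poly p a"
      using value_at_mult[OF assms regular_at_poly, of q a] by (simp add: value_at_poly)
    then have "poly p a = 0" using \<open>poly q a = 0\<close> by simp
    then have "[:- a, 1:] dvd p" "[:- a, 1:] dvd q"
      using \<open>poly q a = 0\<close> by (simp_all add: poly_eq_0_iff_dvd)
    then have "is_unit [:- a, 1:]"
      using \<open>coprime p q\<close> coprime_common_divisor by blast
    then show False by (simp add: is_unit_iff_degree)
  qed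
  then have "degree q = 0"
    using fundamental_theorem_of_algebra constant_degree by metis
  then obtain c where c: "q = [:c:]" by (metis degree_eq_zeroE)
  have "to_fract (smult (inverse c) p) * to_fract q = to_fract p"
    unfolding to_fract_mult[symmetric] using q by (simp add: c)
  then have "f = to_fract (smult (inverse c) p)" using q by (simp add: f divide_eq_eq)
  then show thesis by (rule that)
qed

lemma expand_Infty_poly_nth: "fls_nth (expand Infty (to_fract p)) (- int n) = coeff p n"
proof -
  \<comment> \<open>The vanishing of positive powers is carried along, since multiplication by the
    inverse parameter moves the coefficient of exponent 1 into the constant term.\<close>
  have "fls_nth (expand Infty (to_fract p)) (- int n) = coeff p n \<and>
    fls_nth (expand Infty (to_fract p)) (1 + int k) = 0" for n k
  proof (induction p arbitrary: n k)
    case (pCons c p)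
    have "expand Infty (to_fract (pCons c p)) = fls_const c + fls_X_inv * expand Infty (to_fract p)"
      unfolding to_fract_pCons[of c p] expand_add expand_mult expand_cst expand_ref_coord by simp
    then show ?case
      using pCons(2)[of 0 0] pCons(2)[of "n - 1" "Suc k"]
      by (cases n) (simp_all add: fls_X_inv_times_conv_shift add.commute del: expand.simps)
  qed simp
  then show ?thesis by blast
qed

lemma degree_le_1_if_pole_at_Infty:
  assumes "fls_subdegree (expand Infty (to_fract p)) \<ge> - 1"
  obtains a b where "to_fract p = cst b + ref_coord * cst a"
proof -
  have "degree p \<le> 1"
  proof (rule ccontr)
    assume deg: "\<not> degree p \<le> 1"
    then have "coeff p (degree p) \<noteq> 0" by (intro leading_coeff_neq_0) auto
    then have "fls_subdegree (expand Infty (to_fract p)) \<le> - int (degree p)"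
      by (intro fls_subdegree_leI) (simp add: expand_Infty_poly_nth del: expand.simps)
    then show False using assms deg by linarith
  qed
  then have "p = [:coeff p 0, coeff p 1:]"
    by (intro poly_eqI) (simp add: coeff_pCons coeff_eq_0 split: nat.splits)
  then have "to_fract p = cst (coeff p 0) + ref_coord * cst (coeff p 1)"
    using to_fract_pCons[of "coeff p 0" "[:coeff p 1:]"] by simp
  then show thesis by (rule that)
qed

lemma fls_X_mult_X_inv: "fls_X * fls_X_inv = (1 :: complex fls)"
  by (simp add: fls_X_times_conv_shift fls_X_inv_conv_shift_1)

locale coordinate =
  fixes u :: mero and P :: proj_line
  assumes coordinate: "coordinate_with_pole u P"
begin

lemma regular_iff: "regular_at u z \<longleftrightarrow> z \<noteq> P"
  using coordinate by (auto simp: coordinate_with_pole_def regular_at_def)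

lemma not_constant: "u \<noteq> cst c"
  using regular_at_cst[of c P] regular_iff[of P] by auto

text \<open>If P is infinity, u is a polynomial with a simple pole there, hence of degree 1. If P is
  \<open>Fin t\<close>, multiplying u by \<open>ref_coord - cst t\<close> removes the pole and
  creates at most a simple one at infinity. The relation is kept free of denominators so that it can
  be expanded at any point.\<close>

lemma fractional_linear:
  obtains a b c d where "a * d - b * c \<noteq> 0"
    "u * (cst d + ref_coord * cst c) = cst b + ref_coord * cst a"
proof (cases P)
  case Infty
  have "regular_at u (Fin a)" for a using Infty by (simp add: regular_iff)
  then obtain p where p: "u = to_fract p" by (rule regular_at_all_finite)
  have "fls_subdegree (expand Infty u) = - 1"
    using coordinate Infty by (simp add: coordinate_with_pole_def)
  then have "fls_subdegree (expand Infty (to_fract p)) \<ge> - 1" by (simp only: p)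
  then obtain a b where ab: "u = cst b + ref_coord * cst a"
    unfolding p by (rule degree_le_1_if_pole_at_Infty)
  then have "a \<noteq> 0" using not_constant[of b] by (auto simp: cst_simps)
  with ab show thesis by (intro that[of a 1 b 0]) (simp_all add: cst_simps)
next
  case (Fin t)
  define f where "f = u * (ref_coord - cst t)"
  have u: "fls_subdegree (expand (Fin t) u) = - 1"
    using coordinate Fin by (simp add: coordinate_with_pole_def)
  have lin: "expand (Fin t) (ref_coord - cst t) = fls_X"
    unfolding expand_diff expand_ref_coord expand_cst by simp
  have "regular_at f (Fin s)" for s
  proof (cases "s = t")
    case True
    have "expand (Fin t) u \<noteq> 0" using u by auto
    then show ?thesis
      using u unfolding True f_def regular_at_def expand_mult lin by simp
  next
    case False
    then show ?thesis
      unfolding f_def using Fin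
      by (intro regular_at_mult regular_at_diff regular_at_ref_coord regular_at_cst)
        (simp add: regular_iff)
  qed
  then obtain p where p: "f = to_fract p" by (rule regular_at_all_finite)
  have inf: "expand Infty (ref_coord - cst t) = fls_X_inv - fls_const t"
    unfolding expand_diff expand_ref_coord expand_cst by simp
  have "fls_subdegree (expand Infty f) \<ge> - 1"
  proof -
    have "regular_at u Infty" using Fin by (simp add: regular_iff)
    then obtain G where G: "expand Infty u = fps_to_fls G" unfolding regular_at_iff by blast
    \<comment> \<open>With X = 1/\<open>ref_coord\<close>, the second factor of f is 1/X - t =
      (1/X)(1 - t X), and u is regular here: the pole is at most simple.\<close>
    have "expand Infty f = fls_X_inv * fps_to_fls (G - fps_const t * fps_X * G)"
      unfolding f_def expand_mult inf G
      by (simp add: fls_times_fps_to_fls algebra_simps fls_X_mult_X_inv)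
    then show ?thesis
      by (cases "expand Infty f = 0")
        (auto simp: fls_X_inv_times_conv_shift simp del: expand.simps intro!: fls_subdegree_geI)
  qed
  then obtain a b where ab: "f = cst b + ref_coord * cst a"
    unfolding p by (rule degree_le_1_if_pole_at_Infty)
  \<comment> \<open>A vanishing determinant would let the factor \<open>ref_coord - cst t\<close>
    cancel and leave u equal to the constant a.\<close>
  have "a * (- t) - b * 1 \<noteq> 0"
  proof
    assume "a * (- t) - b * 1 = 0"
    then have "b = - (a * t)" by simp
    then have "u * (ref_coord - cst t) = cst a * (ref_coord - cst t)"
      using ab unfolding f_def by (simp add: cst_simps algebra_simps)
    moreover have "ref_coord - cst t \<noteq> 0"
      using lin by (metis expand_0 fls_X_nonzero)
    ultimately show False using not_constant by simp
  qed
  then show thesis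
    by (rule that) (use ab in \<open>simp add: f_def cst_simps algebra_simps\<close>)
qed

text \<open>If the linear coefficient of u vanished, the coefficients of order 0 and 1 in the
  fractional linear relation would make (a, b) the multiple g (c, d), with g the value of u, against
  the nonzero determinant.\<close>

lemma local_parameter:
  assumes "z \<noteq> P" "expand z u = fps_to_fls G"
  shows "fps_nth G 1 \<noteq> 0"
proof
  assume G1: "fps_nth G 1 = 0"
  obtain a b c d where det: "a * d - b * c \<noteq> 0"
    and fl: "u * (cst d + ref_coord * cst c) = cst b + ref_coord * cst a"
    by (rule fractional_linear)
  define g where "g = fps_nth G 0"
  have "g * c = a \<and> g * d = b"
  proof (cases z)
    case (Fin t)
    have "expand z (u * (cst d + ref_coord * cst c)) = expand z (cst b + ref_coord * cst a)"
      by (simp only: fl)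
    then have "fps_to_fls G * (fls_const d + (fls_const t + fls_X) * fls_const c)
        = fls_const b + (fls_const t + fls_X) * fls_const a"
      unfolding expand_mult expand_add expand_cst expand_ref_coord assms(2) by (simp add: Fin)
    then have "fps_to_fls (G * (fps_const d + (fps_const t + fps_X) * fps_const c))
        = fps_to_fls (fps_const b + (fps_const t + fps_X) * fps_const a)"
      by (simp add: fls_times_fps_to_fls)
    then have *: "G * (fps_const d + (fps_const t + fps_X) * fps_const c)
        = fps_const b + (fps_const t + fps_X) * fps_const a"
      by (simp only: fps_to_fls_eq_iff)
    have 0: "g * (d + t * c) = b + t * a"
      using arg_cong[OF *, of "\<lambda>H. fps_nth H 0"] by (simp add: g_def)
    have 1: "g * c = a"
      using arg_cong[OF *, of "\<lambda>H. fps_nth H 1"] G1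
      by (simp add: fps_mult_nth g_def)
    then show ?thesis using 0 unfolding 1[symmetric] by (simp add: algebra_simps)
  next
    case Infty
    have "expand z (u * (cst d + ref_coord * cst c)) = expand z (cst b + ref_coord * cst a)"
      by (simp only: fl)
    then have "fps_to_fls G * (fls_const d + fls_X_inv * fls_const c)
        = fls_const b + fls_X_inv * fls_const a"
      unfolding expand_mult expand_add expand_cst expand_ref_coord assms(2) by (simp add: Infty)
    \<comment> \<open>Multiplying by the parameter clears the pole of \<open>ref_coord\<close>, so
      that the comparison takes place among power series.\<close>
    then have "fps_to_fls G * (fls_const d + fls_X_inv * fls_const c) * fls_X
        = (fls_const b + fls_X_inv * fls_const a) * fls_X"
      by (simp only:)
    then have "fps_to_fls (G * (fps_const d * fps_X + fps_const c))
        = fps_to_fls (fps_const b * fps_X + fps_const a)"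
      unfolding distrib_right distrib_left mult.assoc fps_to_fls_plus fls_times_fps_to_fls
        fps_const_to_fls fps_X_to_fls
      by (simp add: fls_X_inv_times_conv_shift fls_X_times_conv_shift mult.left_commute[of fls_X_inv])
    then have *: "G * (fps_const d * fps_X + fps_const c) = fps_const b * fps_X + fps_const a"
      by (simp only: fps_to_fls_eq_iff)
    have 0: "g * c = a"
      using arg_cong[OF *, of "\<lambda>H. fps_nth H 0"] by (simp add: g_def)
    have 1: "g * d = b"
      using arg_cong[OF *, of "\<lambda>H. fps_nth H 1"] G1
      by (simp add: fps_mult_nth g_def)
    then show ?thesis using 0 by simp
  qed
  then have "a * d - b * c = 0" by (auto simp: algebra_simps)
  with det show False by simp
qed

lemma deriv_expand_coordinate:
  assumes "z \<noteq> P"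
  obtains G where "expand_form z (differential u) = fps_to_fls G" "fps_nth G 0 \<noteq> 0"
proof -
  obtain G where G: "expand z u = fps_to_fls G"
    using assms unfolding regular_iff[symmetric] regular_at_iff by blast
  then have "expand_form z (differential u) = fps_to_fls (fps_deriv G)"
    unfolding deriv_expand[symmetric] by (simp add: fls_deriv_fps_to_fls)
  moreover have "fps_nth (fps_deriv G) 0 \<noteq> 0"
    using local_parameter[OF assms G] by simp
  ultimately show thesis by (rule that)
qed

lemma differential_nonzero: "differential u \<noteq> 0"
proof
  assume *: "differential u = 0"
  obtain z where "z \<noteq> P" by (metis proj_line.distinct(1))
  then obtain G where "expand_form z (differential u) = fps_to_fls G" "fps_nth G 0 \<noteq> 0"
    by (rule deriv_expand_coordinate)
  then show False by (simp add: * expand_form_def)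
qed

text \<open>Away from P the form du expands to a power series with nonzero constant term, that is, a
  unit; multiplying or dividing by it preserves regularity.\<close>

lemma form_regular_iff:
  assumes "z \<noteq> P"
  shows "form_regular_at \<omega> z \<longleftrightarrow> regular_at (\<omega> / differential u) z"
proof -
  obtain G where G: "expand_form z (differential u) = fps_to_fls G" "fps_nth G 0 \<noteq> 0"
    using deriv_expand_coordinate[OF assms] by blast
  have eq: "expand_form z \<omega> = expand z (\<omega> / differential u) * fps_to_fls G"
    unfolding G(1)[symmetric] expand_form_def mult.assoc[symmetric] expand_mult[symmetric]
    by (simp only: nonzero_divide_eq_eq[OF differential_nonzero] times_divide_eq_left
        nonzero_mult_div_cancel_right[OF differential_nonzero])
  have unit: "fps_to_fls G * fps_to_fls (inverse G) = 1"
    using G(2) by (simp add: inverse_mult_eq_1' flip: fls_times_fps_to_fls)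
  show ?thesis
    unfolding form_regular_at_def fls_subdegree_nonneg_iff regular_at_iff
  proof
    assume "\<exists>F. expand z (\<omega> / differential u) = fps_to_fls F"
    then show "\<exists>F. expand_form z \<omega> = fps_to_fls F"
      unfolding eq by (metis fls_times_fps_to_fls)
  next
    assume "\<exists>F. expand_form z \<omega> = fps_to_fls F"
    then obtain F where "expand_form z \<omega> = fps_to_fls F" by blast
    then have "expand z (\<omega> / differential u) * (fps_to_fls G * fps_to_fls (inverse G))
        = fps_to_fls F * fps_to_fls (inverse G)"
      unfolding eq by (simp only: mult.assoc[symmetric])
    then show "\<exists>F. expand z (\<omega> / differential u) = fps_to_fls F"
      unfolding unit by (metis fls_times_fps_to_fls mult_1_right)
  qed
qed

section \<open>Meromorphic functions as rational functions of \<open>u\<close>\<close>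

lemma subst_hom_u: "subst_hom cst u"
  by unfold_locales (rule cst_simps not_constant)+

interpretation at_u: subst_hom cst u by (rule subst_hom_u)

text \<open>Solving the fractional linear relation for \<open>ref_coord\<close> shows that it is
  rational in u, and every function is rational in \<open>ref_coord\<close>.\<close>

lemma fsub_u_surj: "\<exists>g. f = subst_fract cst g u"
proof -
  obtain a b c d where det: "a * d - b * c \<noteq> 0"
    and fl: "u * (cst d + ref_coord * cst c) = cst b + ref_coord * cst a"
    by (rule fractional_linear)
  \<comment> \<open>Otherwise c is nonzero by the determinant, and u is the constant a/c.\<close>
  have nz: "cst a - u * cst c \<noteq> 0"
  proof
    assume *: "cst a - u * cst c = 0"
    then have "c \<noteq> 0" using det by (auto simp: cst_simps)
    have "u = u * (cst c * cst (1 / c))"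
      unfolding cst_simps(2)[symmetric] using \<open>c \<noteq> 0\<close> by (simp add: cst_simps(3))
    also have "\<dots> = u * cst c * cst (1 / c)" by (simp only: mult.assoc)
    also have "u * cst c = cst a" using * by (simp only: right_minus_eq)
    also have "cst a * cst (1 / c) = cst (a * (1 / c))" by (rule cst_simps(2)[symmetric])
    finally show False using not_constant by blast
  qed
  have "ref_coord * (cst a - u * cst c) = u * cst d - cst b"
    using fl by (simp add: algebra_simps)
  then have "ref_coord = (u * cst d - cst b) / (cst a - u * cst c)"
    using nz by (simp add: eq_divide_eq)
  then have "ref_coord = at_u.fsub
      ((ref_coord * cst d - cst b) / (cst a - ref_coord * cst c))"
    by (simp only: at_u.fsub_divide' at_u.fsub_diff at_u.fsub_mult at_u.fsub_cst
        at_u.fsub_ref_coord)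
  then obtain r where r: "ref_coord = at_u.fsub r" by blast
  have poly: "\<exists>g. to_fract p = at_u.fsub g" for p
  proof (induction p)
    case 0
    show ?case using at_u.fsub_0 by (metis to_fract_0)
  next
    case (pCons c p)
    then obtain g where g: "to_fract p = at_u.fsub g" by blast
    have "to_fract (pCons c p) = at_u.fsub (cst c + r * g)"
      unfolding to_fract_pCons[of c p] g at_u.fsub_add at_u.fsub_mult at_u.fsub_cst
      by (simp only: r[symmetric])
    then show ?case by blast
  qed
  obtain p q where f: "f = to_fract p / to_fract q" by (metis mero_cases)
  from poly[of p] poly[of q] obtain g h where "to_fract p = at_u.fsub g" "to_fract q = at_u.fsub h"
    by blast
  then have "f = at_u.fsub (g / h)" by (simp only: f at_u.fsub_divide')
  then show ?thesis by blast
qed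

definition u_derivative :: "mero \<Rightarrow> mero" where
  "u_derivative f = differential f / differential u"

lemma u_derivative_add: "u_derivative (f + g) = u_derivative f + u_derivative g"
  by (simp add: u_derivative_def differential_add add_divide_distrib)

lemma u_derivative_cst_mult: "u_derivative (cst c * f) = cst c * u_derivative f"
  by (simp add: u_derivative_def differential_mult differential_cst)

lemma u_derivative_psub: "u_derivative (at_u.psub A) = at_u.psub (pderiv A)"
proof -
  have "differential (at_u.psub A) = at_u.psub (pderiv A) * differential u"
  proof (induction A)
    case 0
    show ?case using differential_cst[of 0] by simp
  next
    case (pCons c A)
    then show ?case
      by (simp add: at_u.psub_pCons differential_add differential_mult differential_cst
          pderiv_pCons at_u.psub_add cst_simps algebra_simps)
  qed
  then show ?thesis using differential_nonzero by (simp add: u_derivative_def)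
qed

lemma psub_regular:
  assumes "z \<noteq> P"
  shows "regular_at (at_u.psub A) z \<and> value_at (at_u.psub A) z = poly A (value_at u z)"
proof (induction A)
  case 0
  show ?case using regular_at_cst[of 0 z] value_at_cst[of 0 z] by simp
next
  case (pCons c A)
  moreover have "regular_at u z" using assms by (simp add: regular_iff)
  ultimately show ?case
    by (simp add: at_u.psub_pCons regular_at_add regular_at_mult regular_at_cst value_at_mult
        value_at_add value_at_cst)
qed

text \<open>One reduced fraction A/B serves all points where B does not vanish, not only z0. A zero
  of B at u(z0) is impossible: regularity of f would make it a zero of A too, against
  coprimality.\<close>

theorem rational_in_u:
  assumes "regular_at f z0" "z0 \<noteq> P"
  obtains A B where "poly B (value_at u z0) \<noteq> 0"
    "\<And>z. z \<noteq> P \<Longrightarrow> poly B (value_at u z) \<noteq> 0 \<Longrightarrow>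
      regular_at f z \<and> value_at f z = poly A (value_at u z) / poly B (value_at u z) \<and>
      regular_at (u_derivative f) z \<and>
      value_at (u_derivative f) z =
        poly (pderiv A * B - A * pderiv B) (value_at u z) / (poly B (value_at u z)) ^ 2"
proof -
  obtain g where fg: "f = at_u.fsub g" using fsub_u_surj by blast
  obtain A B where AB: "quot_of_fract g = (A, B)" by fastforce
  have B: "B \<noteq> 0" by (metis AB snd_conv snd_quot_of_fract_nonzero)
  have "coprime A B" using coprime_quot_of_fract[of g] by (simp add: AB)
  have "g = to_fract A / to_fract B"
    using Fract_quot_of_fract[of g] unfolding Fract_conv_to_fract AB by simp
  then have f: "f = at_u.psub A / at_u.psub B" unfolding fg using B by (simp add: at_u.fsub_divide)
  have nz: "at_u.psub B \<noteq> 0" by (rule at_u.psub_nonzero[OF B])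
  have "poly B (value_at u z0) \<noteq> 0"
  proof
    assume B0: "poly B (value_at u z0) = 0"
    have "f * at_u.psub B = at_u.psub A" using nz by (simp add: f)
    then have "value_at f z0 * poly B (value_at u z0) = poly A (value_at u z0)"
      using value_at_mult[OF assms(1), of "at_u.psub B"] psub_regular[OF assms(2)] by simp
    then have "[:- value_at u z0, 1:] dvd A" "[:- value_at u z0, 1:] dvd B"
      using B0 by (simp_all add: poly_eq_0_iff_dvd)
    then have "is_unit [:- value_at u z0, 1:]"
      using \<open>coprime A B\<close> coprime_common_divisor by blast
    then show False by (simp add: is_unit_iff_degree)
  qed
  moreover have "regular_at f z \<and> value_at f z = poly A (value_at u z) / poly B (value_at u z) \<and>
      regular_at (u_derivative f) z \<and>
      value_at (u_derivative f) z =
        poly (pderiv A * B - A * pderiv B) (value_at u z) / (poly B (value_at u z)) ^ 2"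
    if z: "z \<noteq> P" "poly B (value_at u z) \<noteq> 0" for z
  proof -
    have *: "u_derivative f = at_u.psub (pderiv A * B - A * pderiv B) / at_u.psub (B ^ 2)"
    proof -
      have d: "differential (at_u.psub C) = at_u.psub (pderiv C) * differential u" for C
        using u_derivative_psub[of C] differential_nonzero
        by (simp add: u_derivative_def divide_eq_eq)
      have "differential f = at_u.psub (pderiv A * B - A * pderiv B) * differential u
          / at_u.psub B ^ 2"
        unfolding f differential_divide[OF nz] d at_u.psub_diff at_u.psub_mult
        by (simp add: left_diff_distrib right_diff_distrib mult.commute mult.left_commute)
      then show ?thesis
        using differential_nonzero
        by (simp add: u_derivative_def power2_eq_square at_u.psub_mult)
    qed
    have B: "value_at (at_u.psub B) z \<noteq> 0" "value_at (at_u.psub (B ^ 2)) z \<noteq> 0"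
      using psub_regular[OF z(1), of B] psub_regular[OF z(1), of "B ^ 2"] z(2) by simp_all
    note reg = psub_regular[OF z(1), THEN conjunct1]
    show ?thesis
      unfolding * using regular_at_divide[OF reg[of A] reg B(1), folded f]
        regular_at_divide[OF reg reg B(2), of "pderiv A * B - A * pderiv B"]
      by (simp add: psub_regular[OF z(1)])
  qed
  ultimately show thesis by (rule that)
qed

end

section \<open>Rational families\<close>

lemma poly_map_aux_const: "poly (map_poly aux_const A) (aux_const c) = aux_const (poly A c)"
  by (induction A) (simp_all add: map_poly_pCons aux_const_simps)

lemma pderiv_map_aux_const: "pderiv (map_poly aux_const A) = map_poly aux_const (pderiv A)"
proof (rule poly_eqI)
  fix n
  have of_nat: "aux_const (of_nat k) = of_nat k" for k
    by (induction k) (simp_all add: aux_const_simps)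
  show "coeff (pderiv (map_poly aux_const A)) n = coeff (map_poly aux_const (pderiv A)) n"
    unfolding coeff_pderiv coeff_map_poly[of aux_const, OF aux_const_simps(4)] aux_const_simps(2)
      of_nat ..
qed

lemma aux_const_divide: "aux_const (a / b) = aux_const a / aux_const b"
proof (cases "b = 0")
  case False
  then have "aux_const (a / b) * aux_const b = aux_const a"
    by (simp flip: aux_const_simps(2))
  moreover have "aux_const b \<noteq> 0"
    using False aux_const_eq_iff[of b 0] by (simp add: aux_const_simps)
  ultimately show ?thesis by (simp add: eq_divide_eq)
qed (simp add: aux_const_simps)

lemma quotient_rule_add:
  fixes a b c e :: "'a::field"
  assumes "b \<noteq> 0" "e \<noteq> 0"
  shows "((a' * e + a * e' + (c' * b + c * b')) * (b * e) - (a * e + c * b) * (b' * e + b * e')) / (b * e) ^ 2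
    = (a' * b - a * b') / b ^ 2 + (c' * e - c * e') / e ^ 2"
  using assms by (simp add: field_simps power2_eq_square)

lemma quotient_rule_mult:
  fixes a b c e :: "'a::field"
  assumes "b \<noteq> 0" "e \<noteq> 0"
  shows "((a' * c + a * c') * (b * e) - a * c * (b' * e + b * e')) / (b * e) ^ 2
    = (a' * b - a * b') / b ^ 2 * (c / e) + a / b * ((c' * e - c * e') / e ^ 2)"
  using assms by (simp add: field_simps power2_eq_square)

lemma taylor_fraction:
  fixes a b c d e :: "'a::field"
  assumes "b \<noteq> 0" "e \<noteq> 0"
  shows "a / b - d / e - x * (c / e ^ 2) = (e ^ 2 * a - d * e * b - c * (x * b)) / (e ^ 2 * b)"
  using assms by (simp add: field_simps power2_eq_square)

context coordinate
begin

abbreviation s :: "proj_line \<Rightarrow> aux_fun" where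
  "s z \<equiv> aux_const (value_at u z)"

lemma zariski_nhd_iff: "zariski_nhd u z U \<longleftrightarrow> z \<in> U \<and> finite (- U) \<and> P \<notin> U"
  by (auto simp: zariski_nhd_def regular_iff)

lemma zariski_nhd_Int: "zariski_nhd u z U \<Longrightarrow> zariski_nhd u z V \<Longrightarrow> zariski_nhd u z (U \<inter> V)"
  by (auto simp: zariski_nhd_iff)

lemma zariski_nhd_move: "zariski_nhd u z U \<Longrightarrow> y \<in> U \<Longrightarrow> zariski_nhd u y U"
  by (simp add: zariski_nhd_iff)

lemma zariski_nhd_remove:
  "zariski_nhd u z U \<Longrightarrow> finite B \<Longrightarrow> z \<notin> B \<Longrightarrow> zariski_nhd u z (U - B)"
  by (auto simp: zariski_nhd_iff Diff_eq)

lemma zariski_nhd_UNIV: "z \<noteq> P \<Longrightarrow> zariski_nhd u z (- {P})"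
  by (simp add: zariski_nhd_iff)

lemma finite_coordinate_fibre: "finite {z. z \<noteq> P \<and> value_at u z = c}"
  using finite_fibre[OF not_constant, of c] by (simp add: regular_iff)

text \<open>The fibres of u are finite and U is cofinite. Infinitely many values of s are what turns
  an identity between values on U into an identity between polynomials.\<close>

lemma infinite_values:
  assumes "zariski_nhd u z0 U"
  shows "infinite (s ` U)"
proof
  assume "finite (s ` U)"
  moreover have "s ` U = aux_const ` value_at u ` U" by (simp add: image_image)
  moreover have "inj aux_const" by (auto intro: injI simp: aux_const_eq_iff)
  ultimately have "finite (value_at u ` U)" by (metis finite_imageD inj_on_subset subset_UNIV)
  then have "finite (\<Union>c\<in>value_at u ` U. {z. z \<noteq> P \<and> value_at u z = c})"
    using finite_coordinate_fibre by blast
  moreover have "U \<subseteq> (\<Union>c\<in>value_at u ` U. {z. z \<noteq> P \<and> value_at u z = c})"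
    using assms by (auto simp: zariski_nhd_iff)
  ultimately have "finite (U \<union> - U)"
    using assms finite_subset unfolding zariski_nhd_iff by blast
  then have "finite (UNIV :: proj_line set)" by simp
  then have "finite (range Fin)" by (rule rev_finite_subset) simp
  then have "finite (UNIV :: complex set)" by (rule finite_imageD) (simp add: inj_def)
  then show False using infinite_UNIV_char_0 by blast
qed

text \<open>One degree of \<open>has_u_deriv\<close>, detached from \<open>component\<close>: at
  this level the families take values in a field and obey the usual calculus.\<close>

definition family_deriv :: "proj_line \<Rightarrow> (proj_line \<Rightarrow> aux_fun) \<Rightarrow> aux_fun \<Rightarrow> bool" where
  "family_deriv z0 g d \<longleftrightarrow> (\<exists>U p q. zariski_nhd u z0 U \<and>
     (\<forall>z\<in>U. poly q (s z) \<noteq> 0 \<and> g z = poly p (s z) / poly q (s z)) \<and>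
     d = poly (pderiv p * q - p * pderiv q) (s z0) / (poly q (s z0)) ^ 2)"

lemma has_u_deriv_iff:
  "has_u_deriv u F z0 w \<longleftrightarrow> (\<forall>m. family_deriv z0 (\<lambda>z. component m (F z)) (component m w))"
  by (simp add: has_u_deriv_def family_deriv_def represents_def Let_def)

lemma family_derivE:
  assumes "family_deriv z0 g d"
  obtains U q p where "zariski_nhd u z0 U" "z0 \<in> U"
    "\<forall>z\<in>U. poly q (s z) \<noteq> 0" "\<forall>z\<in>U. g z = poly p (s z) / poly q (s z)"
    "d = (poly (pderiv p) (s z0) * poly q (s z0) - poly p (s z0) * poly (pderiv q) (s z0))
      / (poly q (s z0)) ^ 2"
proof -
  obtain U p q where "zariski_nhd u z0 U"
    and "\<forall>z\<in>U. poly q (s z) \<noteq> 0 \<and> g z = poly p (s z) / poly q (s z)"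
    and "d = poly (pderiv p * q - p * pderiv q) (s z0) / (poly q (s z0)) ^ 2"
    using assms unfolding family_deriv_def by blast
  moreover from this have "z0 \<in> U" by (simp add: zariski_nhd_iff)
  ultimately show thesis by (intro that[of U q p]) simp_all
qed

lemma family_derivI:
  assumes "zariski_nhd u z0 U"
    and "\<And>z. z \<in> U \<Longrightarrow> poly q (s z) \<noteq> 0" "\<And>z. z \<in> U \<Longrightarrow> g z = poly p (s z) / poly q (s z)"
    and "d = (poly (pderiv p) (s z0) * poly q (s z0) - poly p (s z0) * poly (pderiv q) (s z0))
      / (poly q (s z0)) ^ 2"
  shows "family_deriv z0 g d"
  unfolding family_deriv_def
proof (intro exI conjI ballI)
  show "d = poly (pderiv p * q - p * pderiv q) (s z0) / (poly q (s z0)) ^ 2"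
    using assms(4) by simp
qed (rule assms; assumption)+

lemma family_deriv_cong:
  assumes "family_deriv z0 g d" "zariski_nhd u z0 V" "\<And>z. z \<in> V \<Longrightarrow> h z = g z"
  shows "family_deriv z0 h d"
proof -
  obtain U q p where *: "zariski_nhd u z0 U" "z0 \<in> U"
    "\<forall>z\<in>U. poly q (s z) \<noteq> 0" "\<forall>z\<in>U. g z = poly p (s z) / poly q (s z)"
    "d = (poly (pderiv p) (s z0) * poly q (s z0) - poly p (s z0) * poly (pderiv q) (s z0))
      / (poly q (s z0)) ^ 2"
    using assms(1) by (rule family_derivE)
  show ?thesis
    by (rule family_derivI[OF zariski_nhd_Int[OF *(1) assms(2)] _ _ *(5)]) (simp_all add: * assms(3))
qed

lemma family_deriv_const: "z0 \<noteq> P \<Longrightarrow> family_deriv z0 (\<lambda>_. c) 0"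
  by (rule family_derivI[OF zariski_nhd_UNIV, where p = "[:c:]" and q = 1]) simp_all

lemma family_deriv_add:
  assumes "family_deriv z0 g d" "family_deriv z0 h e"
  shows "family_deriv z0 (\<lambda>z. g z + h z) (d + e)"
proof -
  obtain U q p where 1: "zariski_nhd u z0 U" "z0 \<in> U"
    "\<forall>z\<in>U. poly q (s z) \<noteq> 0" "\<forall>z\<in>U. g z = poly p (s z) / poly q (s z)"
    "d = (poly (pderiv p) (s z0) * poly q (s z0) - poly p (s z0) * poly (pderiv q) (s z0))
      / (poly q (s z0)) ^ 2"
    using assms(1) by (rule family_derivE)
  obtain U' q' p' where 2: "zariski_nhd u z0 U'" "z0 \<in> U'"
    "\<forall>z\<in>U'. poly q' (s z) \<noteq> 0" "\<forall>z\<in>U'. h z = poly p' (s z) / poly q' (s z)"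
    "e = (poly (pderiv p') (s z0) * poly q' (s z0) - poly p' (s z0) * poly (pderiv q') (s z0))
      / (poly q' (s z0)) ^ 2"
    using assms(2) by (rule family_derivE)
  show ?thesis
  proof (rule family_derivI[OF zariski_nhd_Int[OF 1(1) 2(1)],
        where p = "p * q' + p' * q" and q = "q * q'"])
    fix z assume z: "z \<in> U \<inter> U'"
    then show "poly (q * q') (s z) \<noteq> 0" using 1(3) 2(3) by simp
    show "g z + h z = poly (p * q' + p' * q) (s z) / poly (q * q') (s z)"
      using z 1(3,4) 2(3,4) by (simp add: add_frac_eq)
  next
    show "d + e = (poly (pderiv (p * q' + p' * q)) (s z0) * poly (q * q') (s z0)
        - poly (p * q' + p' * q) (s z0) * poly (pderiv (q * q')) (s z0)) / (poly (q * q') (s z0)) ^ 2"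
      unfolding 1(5) 2(5) pderiv_add pderiv_mult poly_add poly_mult
        quotient_rule_add[OF 1(3)[rule_format, OF 1(2)] 2(3)[rule_format, OF 2(2)], symmetric]
      by (simp only: ac_simps)
  qed
qed

lemma family_deriv_mult:
  assumes "family_deriv z0 g d" "family_deriv z0 h e"
  shows "family_deriv z0 (\<lambda>z. g z * h z) (d * h z0 + g z0 * e)"
proof -
  obtain U q p where 1: "zariski_nhd u z0 U" "z0 \<in> U"
    "\<forall>z\<in>U. poly q (s z) \<noteq> 0" "\<forall>z\<in>U. g z = poly p (s z) / poly q (s z)"
    "d = (poly (pderiv p) (s z0) * poly q (s z0) - poly p (s z0) * poly (pderiv q) (s z0))
      / (poly q (s z0)) ^ 2"
    using assms(1) by (rule family_derivE)
  obtain U' q' p' where 2: "zariski_nhd u z0 U'" "z0 \<in> U'"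
    "\<forall>z\<in>U'. poly q' (s z) \<noteq> 0" "\<forall>z\<in>U'. h z = poly p' (s z) / poly q' (s z)"
    "e = (poly (pderiv p') (s z0) * poly q' (s z0) - poly p' (s z0) * poly (pderiv q') (s z0))
      / (poly q' (s z0)) ^ 2"
    using assms(2) by (rule family_derivE)
  show ?thesis
  proof (rule family_derivI[OF zariski_nhd_Int[OF 1(1) 2(1)],
        where p = "p * p'" and q = "q * q'"])
    fix z assume z: "z \<in> U \<inter> U'"
    then show "poly (q * q') (s z) \<noteq> 0" using 1(3) 2(3) by simp
    show "g z * h z = poly (p * p') (s z) / poly (q * q') (s z)"
      using z 1(4) 2(4) by simp
  next
    show "d * h z0 + g z0 * e = (poly (pderiv (p * p')) (s z0) * poly (q * q') (s z0)
        - poly (p * p') (s z0) * poly (pderiv (q * q')) (s z0)) / (poly (q * q') (s z0)) ^ 2"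
      unfolding 1(5) 2(5) 1(4)[rule_format, OF 1(2)] 2(4)[rule_format, OF 2(2)] pderiv_mult poly_add poly_mult
        quotient_rule_mult[OF 1(3)[rule_format, OF 1(2)] 2(3)[rule_format, OF 2(2)], symmetric]
      by (simp only: ac_simps)
  qed
qed

lemma family_deriv_cmult:
  assumes "family_deriv z0 g d" "z0 \<noteq> P"
  shows "family_deriv z0 (\<lambda>z. c * g z) (c * d)"
  using family_deriv_mult[OF family_deriv_const[OF assms(2), of c] assms(1)] by simp

lemma family_deriv_sum:
  assumes "z0 \<noteq> P" "\<And>i. i \<in> I \<Longrightarrow> family_deriv z0 (g i) (d i)"
  shows "family_deriv z0 (\<lambda>z. \<Sum>i\<in>I. g i z) (\<Sum>i\<in>I. d i)"
proof (cases "finite I")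
  case True
  then show ?thesis
    using assms(2)
    by (induction I) (simp_all add: family_deriv_const[OF assms(1)] family_deriv_add)
qed (simp add: family_deriv_const[OF assms(1)])

text \<open>Two representations agree at infinitely many s, so p q' = p' q as polynomials (primes
  here mark the second fraction). This identity and its derivative at u(z0) equate the two quotient
  rule expressions.\<close>

lemma family_deriv_unique:
  assumes "family_deriv z0 g d" "family_deriv z0 g e"
  shows "d = e"
proof -
  obtain U q p where 1: "zariski_nhd u z0 U" "z0 \<in> U"
    "\<forall>z\<in>U. poly q (s z) \<noteq> 0" "\<forall>z\<in>U. g z = poly p (s z) / poly q (s z)"
    "d = (poly (pderiv p) (s z0) * poly q (s z0) - poly p (s z0) * poly (pderiv q) (s z0))
      / (poly q (s z0)) ^ 2"
    using assms(1) by (rule family_derivE)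
  obtain U' q' p' where 2: "zariski_nhd u z0 U'" "z0 \<in> U'"
    "\<forall>z\<in>U'. poly q' (s z) \<noteq> 0" "\<forall>z\<in>U'. g z = poly p' (s z) / poly q' (s z)"
    "e = (poly (pderiv p') (s z0) * poly q' (s z0) - poly p' (s z0) * poly (pderiv q') (s z0))
      / (poly q' (s z0)) ^ 2"
    using assms(2) by (rule family_derivE)
  have "s ` (U \<inter> U') \<subseteq> {x. poly (p * q' - p' * q) x = 0}"
  proof clarify
    fix z assume z: "z \<in> U" "z \<in> U'"
    have "poly p (s z) / poly q (s z) = poly p' (s z) / poly q' (s z)"
      using 1(4)[rule_format, OF z(1)] 2(4)[rule_format, OF z(2)] by simp
    then show "poly (p * q' - p' * q) (s z) = 0"
      using 1(3)[rule_format, OF z(1)] 2(3)[rule_format, OF z(2)] by (simp add: frac_eq_eq)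
  qed
  then have "p * q' - p' * q = 0"
    using infinite_values[OF zariski_nhd_Int[OF 1(1) 2(1)]] poly_roots_finite finite_subset
    by blast
  then have eq: "p * q' = p' * q" by simp
  define a b c f where "a = poly p (s z0)" "b = poly q (s z0)" "c = poly p' (s z0)" "f = poly q' (s z0)"
  note abcf = this
  define a' b' c' f' where "a' = poly (pderiv p) (s z0)" "b' = poly (pderiv q) (s z0)"
    "c' = poly (pderiv p') (s z0)" "f' = poly (pderiv q') (s z0)"
  note abcf' = this
  have nz: "b \<noteq> 0" "f \<noteq> 0" using 1(2,3) 2(2,3) by (simp_all add: abcf)
  have 3: "a * f = c * b"
    using arg_cong[OF eq, of "\<lambda>r. poly r (s z0)"] by (simp add: abcf)
  have 4: "a * f' + f * a' = c * b' + b * c'"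
    using arg_cong[OF eq, of "\<lambda>r. poly (pderiv r) (s z0)"]
    by (simp add: abcf abcf' pderiv_mult)
  have "(a' * b - a * b') * f ^ 2 = (c' * f - c * f') * b ^ 2"
  proof -
    have "(a' * b - a * b') * f ^ 2 = f * b * (a * f' + f * a') - f * f' * b * a - b' * f * (a * f)"
      by (simp add: algebra_simps power2_eq_square)
    also have "\<dots> = f * b * (c * b' + b * c') - f' * b * (a * f) - b' * f * (a * f)"
      unfolding 4 by (simp add: algebra_simps)
    also have "\<dots> = (c' * f - c * f') * b ^ 2"
      unfolding 3 by (simp add: algebra_simps power2_eq_square)
    finally show ?thesis .
  qed
  then show ?thesis
    unfolding 1(5) 2(5) using nz by (simp add: frac_eq_eq flip: abcf abcf')
qed

lemma family_deriv_rational: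
  assumes "z0 \<noteq> P" "poly B (value_at u z0) \<noteq> 0"
  shows "family_deriv z0 (\<lambda>z. aux_const (poly A (value_at u z) / poly B (value_at u z)))
    (aux_const (poly (pderiv A * B - A * pderiv B) (value_at u z0) / (poly B (value_at u z0)) ^ 2))"
    (is ?D)
    and "zariski_nhd u z0 {z. z \<noteq> P \<and> poly B (value_at u z) \<noteq> 0}" (is ?Z)
proof -
  have "B \<noteq> 0" using assms(2) by auto
  then have "finite (\<Union>c\<in>{c. poly B c = 0}. {z. z \<noteq> P \<and> value_at u z = c})"
    using poly_roots_finite finite_coordinate_fibre by blast
  then have "finite (insert P (\<Union>c\<in>{c. poly B c = 0}. {z. z \<noteq> P \<and> value_at u z = c}))" by simp
  moreover have "- {z. z \<noteq> P \<and> poly B (value_at u z) \<noteq> 0}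
      \<subseteq> insert P (\<Union>c\<in>{c. poly B c = 0}. {z. z \<noteq> P \<and> value_at u z = c})" by auto
  ultimately show ?Z
    using assms finite_subset unfolding zariski_nhd_iff by blast
  then show ?D
  proof (rule family_derivI[where p = "map_poly aux_const A" and q = "map_poly aux_const B"])
    fix z assume "z \<in> {z. z \<noteq> P \<and> poly B (value_at u z) \<noteq> 0}"
    then show "poly (map_poly aux_const B) (s z) \<noteq> 0"
      using aux_const_eq_iff[of _ 0] by (simp add: poly_map_aux_const aux_const_simps)
  qed (simp_all add: poly_map_aux_const pderiv_map_aux_const aux_const_divide aux_const_diff
      aux_const_simps power2_eq_square)
qed

lemma family_deriv_value:
  assumes "regular_at f z0" "z0 \<noteq> P"
  shows "family_deriv z0 (\<lambda>z. aux_const (value_at f z)) (aux_const (value_at (u_derivative f) z0))"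
    and "regular_at (u_derivative f) z0"
proof -
  obtain A B where B: "poly B (value_at u z0) \<noteq> 0"
    and AB: "\<And>z. z \<noteq> P \<Longrightarrow> poly B (value_at u z) \<noteq> 0 \<Longrightarrow>
      regular_at f z \<and> value_at f z = poly A (value_at u z) / poly B (value_at u z) \<and>
      regular_at (u_derivative f) z \<and>
      value_at (u_derivative f) z =
        poly (pderiv A * B - A * pderiv B) (value_at u z) / (poly B (value_at u z)) ^ 2"
    using rational_in_u[OF assms] by metis
  show "regular_at (u_derivative f) z0" using AB[OF assms(2) B] by blast
  show "family_deriv z0 (\<lambda>z. aux_const (value_at f z)) (aux_const (value_at (u_derivative f) z0))"
    using family_deriv_cong[OF family_deriv_rational(1)[OF assms(2) B, of A]
      family_deriv_rational(2)[OF assms(2) B]] AB AB[OF assms(2) B]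
    by simp
qed

text \<open>Meant for x the coordinate u of an auxiliary point, which is never a constant: the only
  excluded point is then P.\<close>

lemma family_deriv_pole:
  assumes "z0 \<noteq> P" "\<And>z. x \<noteq> s z"
  shows "family_deriv z0 (\<lambda>z. a / (x - s z) ^ n) (of_nat n * a / (x - s z0) ^ Suc n)"
proof (rule family_derivI[OF zariski_nhd_UNIV[OF assms(1)], where p = "[:a:]" and q = "[:x, - 1:] ^ n"])
  have nz: "x - s z0 \<noteq> 0" using assms(2) by simp
  have q: "poly ([:x, - 1:] ^ n) (s z) = (x - s z) ^ n" for z by (simp add: poly_power)
  have "poly (pderiv ([:x, - 1:] ^ n)) (s z0) = - of_nat n * (x - s z0) ^ (n - 1)"
    by (cases n) (simp_all add: pderiv_power_Suc poly_power pderiv_pCons del: power_Suc of_nat_Suc)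
  moreover have "of_nat n * (x - s z0) ^ (n - 1) * (x - s z0) ^ Suc n = of_nat n * (x - s z0) ^ n * (x - s z0) ^ n"
    by (cases n) (simp_all add: ac_simps)
  ultimately show "of_nat n * a / (x - s z0) ^ Suc n =
      (poly (pderiv [:a:]) (s z0) * poly ([:x, - 1:] ^ n) (s z0)
        - poly [:a:] (s z0) * poly (pderiv ([:x, - 1:] ^ n)) (s z0))
      / (poly ([:x, - 1:] ^ n) (s z0)) ^ 2"
    unfolding q using nz by (auto simp: frac_eq_eq power2_eq_square ac_simps simp del: power_Suc)
next
  show "poly ([:x, - 1:] ^ n) (s z) \<noteq> 0" for z using assms(2)[of z] by (simp add: poly_power)
  show "a / (x - s z) ^ n = poly [:a:] (s z) / poly ([:x, - 1:] ^ n) (s z)" for z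
    by (simp add: poly_power)
qed

section \<open>Limits of rational families and the second order Taylor remainder\<close>

definition family_limit :: "proj_line \<Rightarrow> (proj_line \<Rightarrow> aux_fun) \<Rightarrow> aux_fun \<Rightarrow> bool" where
  "family_limit z0 g l \<longleftrightarrow> (\<exists>U p q. zariski_nhd u z0 U \<and>
     (\<forall>z\<in>U - {z0}. poly q (s z) \<noteq> 0 \<and> g z = poly p (s z) / poly q (s z)) \<and>
     poly q (s z0) \<noteq> 0 \<and> l = poly p (s z0) / poly q (s z0))"

lemma tends_to_W_iff:
  "tends_to_W u F z0 w \<longleftrightarrow> (\<forall>m. family_limit z0 (\<lambda>z. component m (F z)) (component m w))"
  by (simp add: tends_to_W_def family_limit_def represents_def Let_def)

text \<open>A derivative at z0 comes with a representation valid at z0 itself. So the mere existence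
  of a derivative yields a limit equal to the value.\<close>

lemma family_limit_of_deriv:
  assumes "family_deriv z0 g d"
  shows "family_limit z0 g (g z0)"
proof -
  obtain U q p where "zariski_nhd u z0 U" "z0 \<in> U"
    "\<forall>z\<in>U. poly q (s z) \<noteq> 0" "\<forall>z\<in>U. g z = poly p (s z) / poly q (s z)"
    "d = (poly (pderiv p) (s z0) * poly q (s z0) - poly p (s z0) * poly (pderiv q) (s z0))
      / (poly q (s z0)) ^ 2"
    using assms(1) by (rule family_derivE)
  then show ?thesis unfolding family_limit_def by blast
qed

lemma family_limit_cong:
  assumes "family_limit z0 g l" "zariski_nhd u z0 V" "\<And>z. z \<in> V - {z0} \<Longrightarrow> h z = g z"
  shows "family_limit z0 h l"
proof -
  obtain U p q where 1: "zariski_nhd u z0 U"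
    "\<forall>z\<in>U - {z0}. poly q (s z) \<noteq> 0 \<and> g z = poly p (s z) / poly q (s z)"
    "poly q (s z0) \<noteq> 0" "l = poly p (s z0) / poly q (s z0)"
    using assms(1) unfolding family_limit_def by blast
  have "\<forall>z\<in>U \<inter> V - {z0}. poly q (s z) \<noteq> 0 \<and> h z = poly p (s z) / poly q (s z)"
    using 1(2) assms(3) by simp
  then show ?thesis
    unfolding family_limit_def using zariski_nhd_Int[OF 1(1) assms(2)] 1(3,4) by blast
qed

lemma family_limit_add:
  assumes "family_limit z0 g l" "family_limit z0 h k"
  shows "family_limit z0 (\<lambda>z. g z + h z) (l + k)"
proof -
  obtain U p q where 1: "zariski_nhd u z0 U"
    "\<forall>z\<in>U - {z0}. poly q (s z) \<noteq> 0 \<and> g z = poly p (s z) / poly q (s z)"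
    "poly q (s z0) \<noteq> 0" "l = poly p (s z0) / poly q (s z0)"
    using assms(1) unfolding family_limit_def by blast
  obtain U' p' q' where 2: "zariski_nhd u z0 U'"
    "\<forall>z\<in>U' - {z0}. poly q' (s z) \<noteq> 0 \<and> h z = poly p' (s z) / poly q' (s z)"
    "poly q' (s z0) \<noteq> 0" "k = poly p' (s z0) / poly q' (s z0)"
    using assms(2) unfolding family_limit_def by blast
  have "\<forall>z\<in>U \<inter> U' - {z0}. poly (q * q') (s z) \<noteq> 0 \<and>
      g z + h z = poly (p * q' + p' * q) (s z) / poly (q * q') (s z)"
    using 1(2) 2(2) by (simp add: add_frac_eq)
  moreover have "poly (q * q') (s z0) \<noteq> 0" using 1(3) 2(3) by simp
  moreover have "l + k = poly (p * q' + p' * q) (s z0) / poly (q * q') (s z0)"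
    using 1(3,4) 2(3,4) by (simp add: add_frac_eq)
  ultimately show ?thesis
    unfolding family_limit_def using zariski_nhd_Int[OF 1(1) 2(1)] by blast
qed

text \<open>Over the common denominator q0^2 q, the Taylor remainder of p/q has a numerator N with a
  double zero at u(z0). Writing N = X^2 M cancels the pole, and twice M is read off from the second
  derivative of N.\<close>

lemma family_limit_taylor:
  assumes V: "zariski_nhd u z0 V"
    and d1: "\<And>y. y \<in> V \<Longrightarrow> family_deriv y g (g1 y)"
    and d2: "family_deriv z0 g1 g2"
  shows "family_limit z0 (\<lambda>z. 2 / (s z - s z0) ^ 2 * (g z - g z0 - (s z - s z0) * g1 z0)) g2"
proof -
  have "z0 \<in> V" using V by (simp add: zariski_nhd_iff)
  obtain U q p where U: "zariski_nhd u z0 U" "z0 \<in> U"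
    and q: "\<forall>z\<in>U. poly q (s z) \<noteq> 0" and g: "\<forall>z\<in>U. g z = poly p (s z) / poly q (s z)"
    using d1[OF \<open>z0 \<in> V\<close>] by (rule family_derivE)
  define p1 where "p1 = pderiv p * q - p * pderiv q"
  \<comment> \<open>\<open>g1\<close> is given only pointwise as a derivative; uniqueness identifies
    it with the quotient rule fraction on a whole neighbourhood, which can then be differentiated
    again.\<close>
  have g1: "g1 y = poly p1 (s y) / poly (q ^ 2) (s y)" if "y \<in> U \<inter> V" for y
  proof (rule family_deriv_unique)
    show "family_deriv y g (g1 y)" using d1 that by simp
    show "family_deriv y g (poly p1 (s y) / poly (q ^ 2) (s y))"
      by (rule family_derivI[OF zariski_nhd_move[OF U(1)], of _ q _ p])
        (use that q g in \<open>simp_all add: p1_def poly_power\<close>)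
  qed
  have "family_deriv z0 g1 ((poly (pderiv p1) (s z0) * poly (q ^ 2) (s z0)
      - poly p1 (s z0) * poly (pderiv (q ^ 2)) (s z0)) / (poly (q ^ 2) (s z0)) ^ 2)"
    by (rule family_derivI[OF zariski_nhd_Int[OF U(1) V], of "q ^ 2" _ p1])
      (use q g1 in \<open>simp_all add: poly_power\<close>)
  then have g2: "g2 = (poly (pderiv p1) (s z0) * poly (q ^ 2) (s z0)
      - poly p1 (s z0) * poly (pderiv (q ^ 2)) (s z0)) / (poly (q ^ 2) (s z0)) ^ 2"
    using d2 family_deriv_unique by blast
  define p0 q0 p0' q0' p0'' q0'' where defs: "p0 = poly p (s z0)" "q0 = poly q (s z0)"
    "p0' = poly (pderiv p) (s z0)" "q0' = poly (pderiv q) (s z0)"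
    "p0'' = poly (pderiv (pderiv p)) (s z0)" "q0'' = poly (pderiv (pderiv q)) (s z0)"
  have q0: "q0 \<noteq> 0" using q U(2) by (simp add: defs)
  define X where "X = [:- s z0, 1:]"
  have X: "poly X x = x - s z0" "pderiv X = 1" for x by (simp_all add: X_def pderiv_pCons)
  define c where "c = p0' * q0 - p0 * q0'"
  define N where "N = smult (q0 ^ 2) p - smult (p0 * q0) q - smult c (X * q)"
  have "poly N (s z0) = 0" by (simp add: N_def X power2_eq_square flip: defs)
  then obtain N1 where N1: "N = X * N1" unfolding X_def poly_eq_0_iff_dvd by (auto elim: dvdE)
  have dN: "pderiv N = smult (q0 ^ 2) (pderiv p) - smult (p0 * q0) (pderiv q)
      - smult c (X * pderiv q + q)"
    by (simp add: N_def pderiv_diff pderiv_smult pderiv_mult X)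
  have ddN: "pderiv (pderiv N) = smult (q0 ^ 2) (pderiv (pderiv p))
      - smult (p0 * q0) (pderiv (pderiv q)) - smult c (X * pderiv (pderiv q) + 2 * pderiv q)"
    by (simp add: dN pderiv_diff pderiv_add pderiv_smult pderiv_mult X add.commute)
  have "poly N1 (s z0) = poly (pderiv N) (s z0)" by (simp add: N1 pderiv_mult X)
  also have "\<dots> = 0"
    unfolding dN by (simp add: X c_def algebra_simps power2_eq_square flip: defs)
  finally obtain M where M: "N1 = X * M" unfolding X_def poly_eq_0_iff_dvd by (auto elim: dvdE)
  have "2 * poly M (s z0) = poly (pderiv (pderiv N)) (s z0)"
    by (simp add: N1 M pderiv_mult pderiv_add X)
  also have "\<dots> = q0 ^ 2 * p0'' - p0 * q0 * q0'' - 2 * c * q0'"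
    unfolding ddN by (simp add: X algebra_simps flip: defs)
  finally have M0: "2 * poly M (s z0) = q0 ^ 2 * p0'' - p0 * q0 * q0'' - 2 * c * q0'" .
  \<comment> \<open>The finitely many other points over the same value of u are cut out, so that the
    division by (s z - s z0)^2 is legitimate.\<close>
  define B where "B = {z. z \<noteq> P \<and> value_at u z = value_at u z0} - {z0}"
  have "finite B" unfolding B_def using finite_coordinate_fibre by simp
  then have UB: "zariski_nhd u z0 (U \<inter> V - B)"
    by (intro zariski_nhd_remove zariski_nhd_Int U(1) V) (simp_all add: B_def)
  show ?thesis
    unfolding family_limit_def
  proof (intro exI conjI ballI)
    show "zariski_nhd u z0 (U \<inter> V - B)" by (rule UB)
    show "poly (smult (q0 ^ 2) q) (s z0) \<noteq> 0" using q0 by (simp flip: defs)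
    show "g2 = poly (smult 2 M) (s z0) / poly (smult (q0 ^ 2) q) (s z0)"
    proof -
      have "poly (pderiv p1) (s z0) = p0'' * q0 - p0 * q0''"
        by (simp add: p1_def pderiv_diff pderiv_mult algebra_simps flip: defs)
      moreover have "poly p1 (s z0) = c" by (simp add: p1_def c_def flip: defs)
      moreover have "poly (pderiv (q ^ 2)) (s z0) = 2 * q0 * q0'"
        by (simp add: power2_eq_square pderiv_mult flip: defs)
      ultimately have "g2 = ((p0'' * q0 - p0 * q0'') * q0 ^ 2 - c * (2 * q0 * q0')) / (q0 ^ 2) ^ 2"
        unfolding g2 poly_power defs(2)[symmetric] by simp
      also have "\<dots> = (2 * poly M (s z0)) / (q0 ^ 2 * q0)"
        unfolding M0 using q0 by (simp add: frac_eq_eq power2_eq_square algebra_simps)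
      finally show ?thesis by (simp flip: defs)
    qed
  next
    fix z assume z: "z \<in> U \<inter> V - B - {z0}"
    then have "z \<noteq> P" using U(1) by (auto simp: zariski_nhd_iff)
    then have "value_at u z \<noteq> value_at u z0" using z by (auto simp: B_def)
    then have \<Delta>: "s z - s z0 \<noteq> 0" by (simp add: aux_const_eq_iff)
    have qz: "poly q (s z) \<noteq> 0" using q z by simp
    then show "poly (smult (q0 ^ 2) q) (s z) \<noteq> 0" using q0 by simp
    have "poly N (s z) = (s z - s z0) ^ 2 * poly M (s z)"
      by (simp add: N1 M X power2_eq_square)
    moreover have "poly N (s z)
        = q0 ^ 2 * poly p (s z) - p0 * q0 * poly q (s z) - c * ((s z - s z0) * poly q (s z))"
      by (simp add: N_def X)
    ultimately have N: "q0 ^ 2 * poly p (s z) - p0 * q0 * poly q (s z)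
        - c * ((s z - s z0) * poly q (s z)) = (s z - s z0) ^ 2 * poly M (s z)" by simp
    have g_z: "g z = poly p (s z) / poly q (s z)" using g z by simp
    have g_z0: "g z0 = p0 / q0" using g U(2) by (simp flip: defs)
    have g1_z0: "g1 z0 = c / q0 ^ 2"
      using g1[of z0] U(2) \<open>z0 \<in> V\<close> by (simp add: p1_def c_def poly_power flip: defs)
    have "g z - g z0 - (s z - s z0) * g1 z0
        = (q0 ^ 2 * poly p (s z) - p0 * q0 * poly q (s z) - c * ((s z - s z0) * poly q (s z)))
          / (q0 ^ 2 * poly q (s z))"
      unfolding g_z g_z0 g1_z0 by (rule taylor_fraction[OF qz q0])
    then show "2 / (s z - s z0) ^ 2 * (g z - g z0 - (s z - s z0) * g1 z0)
        = poly (smult 2 M) (s z) / poly (smult (q0 ^ 2) q) (s z)"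
      unfolding N using \<Delta> by simp
  qed
qed

section \<open>Families in the symmetric algebra\<close>

text \<open>Unlike \<open>has_u_deriv\<close>, which only concerns the components, this notion has a product rule:
  a component of a product is not determined by the same component of the factors.\<close>

definition W_deriv :: "proj_line \<Rightarrow> (proj_line \<Rightarrow> sym) \<Rightarrow> sym \<Rightarrow> bool" where
  "W_deriv z0 F w \<longleftrightarrow>
     (\<forall>S n. family_deriv z0 (\<lambda>z. coeff (point_lift S (F z)) n) (coeff (point_lift S w) n))"

lemma W_deriv_component:
  assumes "W_deriv z0 F w" "z0 \<noteq> P"
  shows "family_deriv z0 (\<lambda>z. component m (F z)) (component m w)"
  unfolding component_eq ryser_component_def
  by (intro family_deriv_sum family_deriv_cmult assms(2))
    (use assms(1) in \<open>simp add: W_deriv_def\<close>)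

lemma point_lift_0: "point_lift S 0 = 0"
  using point_lift_scalar[of S 0] by (simp add: aux_const_simps)

lemma W_deriv_const: "z0 \<noteq> P \<Longrightarrow> W_deriv z0 (\<lambda>_. v) 0"
  by (simp add: W_deriv_def point_lift_0 family_deriv_const)

lemma W_deriv_add: "W_deriv z0 F v \<Longrightarrow> W_deriv z0 G w \<Longrightarrow> W_deriv z0 (\<lambda>z. F z + G z) (v + w)"
  by (simp add: W_deriv_def point_lift_add family_deriv_add)

lemma W_deriv_mult:
  assumes "W_deriv z0 F v" "W_deriv z0 G w" "z0 \<noteq> P"
  shows "W_deriv z0 (\<lambda>z. F z * G z) (v * G z0 + F z0 * w)"
  unfolding W_deriv_def
proof (intro allI)
  fix S n
  have "family_deriv z0
      (\<lambda>z. \<Sum>i\<le>n. coeff (point_lift S (F z)) i * coeff (point_lift S (G z)) (n - i))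
      (\<Sum>i\<le>n. coeff (point_lift S v) i * coeff (point_lift S (G z0)) (n - i)
        + coeff (point_lift S (F z0)) i * coeff (point_lift S w) (n - i))"
    by (intro family_deriv_sum family_deriv_mult assms(3))
      (use assms(1,2) in \<open>simp_all add: W_deriv_def\<close>)
  then show "family_deriv z0 (\<lambda>z. coeff (point_lift S (F z * G z)) n)
      (coeff (point_lift S (v * G z0 + F z0 * w)) n)"
    by (simp only: point_lift_add point_lift_mult coeff_add coeff_mult sum.distrib)
qed

lemma W_deriv_cmult:
  assumes "W_deriv z0 F v" "z0 \<noteq> P"
  shows "W_deriv z0 (\<lambda>z. w * F z) (w * v)"
  using W_deriv_mult[OF W_deriv_const[OF assms(2), of w] assms(1,2)] by simp

lemma W_deriv_scalar:
  assumes "family_deriv z0 (\<lambda>z. aux_const (r z)) (aux_const d)" "z0 \<noteq> P"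
  shows "W_deriv z0 (\<lambda>z. scalar (r z)) (scalar d)"
  unfolding W_deriv_def
proof (intro allI)
  show "family_deriv z0 (\<lambda>z. coeff (point_lift S (scalar (r z))) n)
      (coeff (point_lift S (scalar d)) n)" for S n
    using assms(1) family_deriv_const[OF assms(2), of 0]
    by (cases n) (simp_all add: point_lift_scalar)
qed

text \<open>A generator occupies only coefficient 1 of \<open>point_lift\<close>, as a sum of values
  at auxiliary points; the other coefficients are constantly 0.\<close>

lemma W_deriv_gen:
  assumes "\<And>j. family_deriv z0 (\<lambda>z. form_at_aux (\<alpha> z) j) (form_at_aux \<beta> j)" "z0 \<noteq> P"
  shows "W_deriv z0 (\<lambda>z. gen (\<alpha> z)) (gen \<beta>)"
  unfolding W_deriv_def
proof (intro allI)
  fix S and n :: nat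
  consider "n = 0" | "n = 1" | "n \<noteq> 0" "n \<noteq> 1" by blast
  then show "family_deriv z0 (\<lambda>z. coeff (point_lift S (gen (\<alpha> z))) n)
      (coeff (point_lift S (gen \<beta>)) n)"
  proof cases
    case 2
    have "family_deriv z0 (\<lambda>z. \<Sum>j\<in>S. form_at_aux (\<alpha> z) j) (\<Sum>j\<in>S. form_at_aux \<beta> j)"
      by (intro family_deriv_sum assms)
    then show ?thesis using 2 by (simp add: point_lift_gen)
  qed (use family_deriv_const[OF assms(2), of 0] in \<open>simp_all add: point_lift_gen coeff_pCons split: nat.split\<close>)
qed

lemma W_deriv_cong:
  assumes "W_deriv z0 F w" "zariski_nhd u z0 V" "\<And>z. z \<in> V \<Longrightarrow> G z = F z"
  shows "W_deriv z0 G w"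
  unfolding W_deriv_def
proof (intro allI)
  fix S n
  have "family_deriv z0 (\<lambda>z. coeff (point_lift S (F z)) n) (coeff (point_lift S w) n)"
    using assms(1) by (simp add: W_deriv_def)
  then show "family_deriv z0 (\<lambda>z. coeff (point_lift S (G z)) n) (coeff (point_lift S w) n)"
    by (rule family_deriv_cong[OF _ assms(2)]) (simp add: assms(3))
qed

section \<open>The fields and their derivatives\<close>

text \<open>The \<open>k\<close>-th derivative of the field \<open>i\<close> with respect to \<open>u(z)\<close>.\<close>

definition contraction :: "nat \<Rightarrow> proj_line \<Rightarrow> sym \<Rightarrow> sym" where
  "contraction k z = sym_derivation
     (\<lambda>\<alpha>. - value_at ((u_derivative ^^ k) (Rep_kform \<alpha> / differential u)) z)"

text \<open>\<open>value_at\<close> is a coefficient of the expansion and thus linear on all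
  functions, even at poles. Each \<open>contraction\<close> is therefore a derivation on the whole
  of W.\<close>

lemma linear_functional_value:
  "linear_functional (\<lambda>\<alpha>. - value_at ((u_derivative ^^ k) (Rep_kform \<alpha> / differential u)) z)"
proof -
  have add: "(u_derivative ^^ k) (f + g) = (u_derivative ^^ k) f + (u_derivative ^^ k) g" for f g
    by (induction k) (simp_all add: u_derivative_add)
  have mult: "(u_derivative ^^ k) (cst c * f) = cst c * (u_derivative ^^ k) f" for c f
    by (induction k) (simp_all add: u_derivative_cst_mult)
  show ?thesis
    unfolding linear_functional_def
    by (simp add: add_divide_distrib add value_at_add mult value_at_cst_mult
        flip: times_divide_eq_right)
qed

lemmas contraction_add = sym_derivation_add[OF linear_functional_value, folded contraction_def]
  and contraction_mult = sym_derivation_mult[OF linear_functional_value, folded contraction_def]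
  and contraction_scalar = sym_derivation_scalar[OF linear_functional_value, folded contraction_def]
  and contraction_gen = sym_derivation_gen[OF linear_functional_value, folded contraction_def]

lemma contraction_0 [simp]: "contraction k z 0 = 0"
  using contraction_scalar[of k z 0] by simp

lemma K_reg_iff: "z \<noteq> P \<Longrightarrow> \<alpha> \<in> K_reg z \<longleftrightarrow> regular_at (Rep_kform \<alpha> / differential u) z"
  by (simp add: K_reg_def form_regular_iff)

lemma W_reg_0: "0 \<in> W_reg z"
  using W_reg.intros(1)[of 0] by simp

text \<open>Generators are sent to scalars, so the point y of contraction is unrelated to z; this
  permits contractions at z1 and z2 to be nested.\<close>

lemma contraction_W_reg: "v \<in> W_reg z \<Longrightarrow> contraction k y v \<in> W_reg z"
  by (induction rule: W_reg.induct)
    (simp_all add: contraction_scalar contraction_gen contraction_add contraction_mult W_reg_0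
      W_reg.intros)

text \<open>An element is built from finitely many forms, each with finitely many poles.\<close>

lemma W_reg_nhd:
  assumes "v \<in> W_reg z0" "z0 \<noteq> P"
  shows "\<exists>U. zariski_nhd u z0 U \<and> (\<forall>z\<in>U. v \<in> W_reg z)"
  using assms(1)
proof (induction rule: W_reg.induct)
  case (1 c)
  show ?case using zariski_nhd_UNIV[OF assms(2)] W_reg.intros(1) by blast
next
  case (2 \<alpha>)
  define f where "f = Rep_kform \<alpha> / differential u"
  have "regular_at f z0" using 2 K_reg_iff[OF assms(2)] by (simp add: f_def)
  then have "zariski_nhd u z0 (- {P} - {z. \<not> regular_at f z})"
    by (intro zariski_nhd_remove zariski_nhd_UNIV assms(2) finite_poles) simp
  moreover have "\<forall>z\<in>- {P} - {z. \<not> regular_at f z}. gen \<alpha> \<in> W_reg z"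
    using K_reg_iff by (auto simp: f_def intro!: W_reg.intros(2))
  ultimately show ?case by blast
next
  case (3 v w)
  then obtain U V where "zariski_nhd u z0 U" "\<forall>z\<in>U. v \<in> W_reg z"
    and "zariski_nhd u z0 V" "\<forall>z\<in>V. w \<in> W_reg z" by blast
  then show ?case
    using zariski_nhd_Int[of z0 U V] W_reg.intros(3) by (intro exI[of _ "U \<inter> V"]) simp
next
  case (4 v w)
  then obtain U V where "zariski_nhd u z0 U" "\<forall>z\<in>U. v \<in> W_reg z"
    and "zariski_nhd u z0 V" "\<forall>z\<in>V. w \<in> W_reg z" by blast
  then show ?case
    using zariski_nhd_Int[of z0 U V] W_reg.intros(4) by (intro exI[of _ "U \<inter> V"]) simp
qed

lemma regular_u_derivative_iter:
  assumes "regular_at f z" "z \<noteq> P"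
  shows "regular_at ((u_derivative ^^ k) f) z"
  using assms by (induction k) (simp_all add: family_deriv_value(2))

lemma W_deriv_contraction:
  assumes "v \<in> W_reg z0" "z0 \<noteq> P"
  shows "W_deriv z0 (\<lambda>z. contraction k z v) (contraction (Suc k) z0 v)"
  using assms(1)
proof (induction rule: W_reg.induct)
  case (1 c)
  show ?case by (simp add: contraction_scalar W_deriv_const[OF assms(2)])
next
  case (2 \<alpha>)
  define f where "f = (u_derivative ^^ k) (Rep_kform \<alpha> / differential u)"
  have "regular_at f z0"
    using 2 K_reg_iff[OF assms(2)] assms(2) by (simp add: f_def regular_u_derivative_iter)
  then have "family_deriv z0 (\<lambda>z. - 1 * aux_const (value_at f z))
      (- 1 * aux_const (value_at (u_derivative f) z0))"
    using assms(2) by (intro family_deriv_cmult family_deriv_value)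
  then have "family_deriv z0 (\<lambda>z. aux_const (- value_at f z))
      (aux_const (- value_at (u_derivative f) z0))"
    by (simp add: aux_const_simps)
  then show ?case
    unfolding contraction_gen funpow.simps(2) o_apply f_def[symmetric]
    by (rule W_deriv_scalar[OF _ assms(2)])
next
  case (3 v w)
  then show ?case by (simp add: contraction_add W_deriv_add)
next
  case (4 v w)
  have "W_deriv z0 (\<lambda>z. contraction k z v * w + v * contraction k z w)
      ((contraction (Suc k) z0 v * w + contraction k z0 v * 0) + v * contraction (Suc k) z0 w)"
    by (intro W_deriv_add W_deriv_mult W_deriv_cmult W_deriv_const assms(2) 4)
  then show ?case by (simp add: contraction_mult)
qed

text \<open>Both contractions move with z, so \<open>W_deriv_contraction\<close> does not apply to
  the composite; expanding by Leibniz reduces it to generators, where the second contraction meets a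
  scalar. Only existence is needed, to obtain a limit.\<close>

lemma W_deriv_contraction_twice:
  assumes "v \<in> W_reg z0" "z0 \<noteq> P"
  shows "\<exists>w. W_deriv z0 (\<lambda>z. contraction 0 z (contraction 0 z v)) w"
  using assms(1)
proof (induction rule: W_reg.induct)
  case (1 c)
  show ?case using W_deriv_const[OF assms(2), of 0] by (auto simp: contraction_scalar)
next
  case (2 \<alpha>)
  show ?case using W_deriv_const[OF assms(2), of 0] by (auto simp: contraction_scalar contraction_gen)
next
  case (3 v w)
  then obtain a b where "W_deriv z0 (\<lambda>z. contraction 0 z (contraction 0 z v)) a"
    "W_deriv z0 (\<lambda>z. contraction 0 z (contraction 0 z w)) b" by blast
  from W_deriv_add[OF this] show ?case by (auto simp: contraction_add)
next
  case (4 v w)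
  then obtain a b where ab: "W_deriv z0 (\<lambda>z. contraction 0 z (contraction 0 z v)) a"
    "W_deriv z0 (\<lambda>z. contraction 0 z (contraction 0 z w)) b" by blast
  note v = W_deriv_contraction[OF 4(1) assms(2), of 0]
  note w = W_deriv_contraction[OF 4(2) assms(2), of 0]
  note mult = W_deriv_mult[OF _ _ assms(2)]
  have "\<exists>d. W_deriv z0 (\<lambda>z. (contraction 0 z (contraction 0 z v) * w
      + contraction 0 z v * contraction 0 z w)
      + (contraction 0 z v * contraction 0 z w + v * contraction 0 z (contraction 0 z w))) d"
    by (rule exI, rule W_deriv_add[OF W_deriv_add[OF mult[OF ab(1) W_deriv_const[OF assms(2)]]
          mult[OF v w]] W_deriv_add[OF mult[OF v w] W_deriv_cmult[OF ab(2) assms(2)]]])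
  then show ?case by (simp add: contraction_add contraction_mult)
qed

lemma is_i_hat_contraction:
  assumes "z \<noteq> P"
  shows "is_i_hat u z (contraction 0 z)"
  unfolding is_i_hat_def form_value_def using contraction_scalar[of 0 z 1]
  by (simp add: contraction_W_reg contraction_add contraction_mult contraction_scalar
      contraction_gen)

text \<open>Scalars are killed because of D 1 = 0 and homogeneity, the generators are prescribed,
  and additivity and Leibniz propagate this through \<open>W_reg z\<close>.\<close>

lemma is_i_hat_unique:
  assumes D: "is_i_hat u z D" and E: "is_i_hat u z E" and v: "v \<in> W_reg z"
  shows "D v = E v"
  using v
proof (induction rule: W_reg.induct)
  case (1 c)
  have "F (scalar c) = 0" if "is_i_hat u z F" for F
  proof -
    have "1 \<in> W_reg z" using W_reg.intros(1)[of 1] by simp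
    then have "F (scalar c * 1) = scalar c * F 1" using that unfolding is_i_hat_def by blast
    also have "F 1 = 0" using that unfolding is_i_hat_def by blast
    finally show ?thesis by simp
  qed
  then show ?case using D E by metis
next
  case (2 \<alpha>)
  then show ?case using D E unfolding is_i_hat_def by simp
next
  case (3 v w)
  have "F (v + w) = F v + F w" if "is_i_hat u z F" for F
    using that 3(1,2) unfolding is_i_hat_def by blast
  from this[OF D] this[OF E] show ?case using 3(3,4) by simp
next
  case (4 v w)
  have "F (v * w) = F v * w + v * F w" if "is_i_hat u z F" for F
    using that 4(1,2) unfolding is_i_hat_def by blast
  from this[OF D] this[OF E] show ?case using 4(3,4) by simp
qed

lemma i_hat_eq:
  assumes "z \<noteq> P" "v \<in> W_reg z"
  shows "i_hat u z v = contraction 0 z v"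
proof (rule is_i_hat_unique[OF _ is_i_hat_contraction[OF assms(1)] assms(2)])
  show "is_i_hat u z (i_hat u z)"
    unfolding i_hat_def
    by (rule someI[of "is_i_hat u z", OF is_i_hat_contraction[OF assms(1)]])
qed

text \<open>The \<open>k\<close>-th derivative of \<open>e_form u z\<close> with respect to \<open>u(z)\<close>.\<close>

definition pole_form :: "nat \<Rightarrow> proj_line \<Rightarrow> kform" where
  "pole_form k z = Abs_kform (differential (cst (fact k) / (u - cst (value_at u z)) ^ Suc k))"

lemma differential_power: "differential (g ^ Suc n) = cst (of_nat (Suc n)) * g ^ n * differential g"
proof (induction n)
  case (Suc n)
  have "differential (g ^ Suc (Suc n)) = differential g * g ^ Suc n + g * differential (g ^ Suc n)"
    unfolding power_Suc[of g "Suc n"] differential_mult ..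
  also have "\<dots> = differential g * g ^ Suc n + g * (cst (of_nat (Suc n)) * g ^ n * differential g)"
    unfolding Suc ..
  also have "\<dots> = (cst (of_nat (Suc n)) + 1) * g ^ Suc n * differential g"
    by (simp add: algebra_simps)
  also have "cst (of_nat (Suc n)) + 1 = cst (of_nat (Suc (Suc n)))"
    using cst_simps(1)[of "of_nat (Suc n)" 1] by (simp add: cst_simps(3) add.commute)
  finally show ?case .
qed (simp add: cst_simps)

text \<open>The primitive k!/(u - s)^(k+1) is the k-th derivative of 1/(u - s) in s, and this
  derivative commutes with the differential on the projective line.\<close>

lemma Rep_pole_form:
  "Rep_kform (pole_form k z)
    = cst (- fact (Suc k)) * differential u / (u - cst (value_at u z)) ^ Suc (Suc k)"
proof -
  define g where "g = u - cst (value_at u z)"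
  have g: "g \<noteq> 0" using not_constant by (simp add: g_def)
  have dg: "differential g = differential u"
    by (simp add: g_def differential_diff differential_cst)
  have "differential (cst (fact k) / g ^ Suc k)
      = (0 * g ^ Suc k - cst (fact k) * (cst (of_nat (Suc k)) * g ^ k * differential u))
        / (g ^ Suc k) ^ 2"
    using g by (subst differential_divide) (simp_all only: power_not_zero not_False_eq_True
        differential_cst differential_power dg)
  also have "\<dots> = - (cst (fact k) * cst (of_nat (Suc k))) * differential u / g ^ Suc (Suc k)"
    using g by (simp add: divide_simps power2_eq_square)
  also have "- (cst (fact k) * cst (of_nat (Suc k))) = cst (- fact (Suc k))"
    unfolding cst_simps(2,5)[symmetric] by (simp add: mult.commute)
  finally show ?thesis
    unfolding pole_form_def Rep_kform_differential g_def .
qed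

lemma pole_form_0: "pole_form 0 z = e_form u z"
proof -
  have "Rep_kform (pole_form 0 z) = Rep_kform (e_form u z)"
    unfolding Rep_e_form[OF not_constant] Rep_pole_form
    by (simp add: cst_simps power2_eq_square)
  then show ?thesis by (simp only: Rep_kform_inject)
qed

lemma form_at_aux_pole_form:
  "form_at_aux (pole_form k z) j
    = - aux_const (fact (Suc k)) * subst_fract aux_const (differential u) (aux_point j)
      / (subst_fract aux_const u (aux_point j) - s z) ^ Suc (Suc k)"
proof -
  interpret aux: subst_hom aux_const "aux_point j" by (rule subst_hom_aux)
  show ?thesis
    unfolding form_at_aux_def Rep_pole_form aux.fsub_divide' aux.fsub_mult aux.fsub_cst
      aux.fsub_power aux.fsub_diff aux_const_simps(5) ..
qed

lemma aux_coordinate_nonconst: "subst_fract aux_const u (aux_point j) \<noteq> s z"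
proof -
  interpret aux: subst_hom aux_const "aux_point j" by (rule subst_hom_aux)
  show ?thesis
    unfolding aux.fsub_cst[symmetric] aux.fsub_eq_iff by (rule not_constant)
qed

lemma W_deriv_pole_form:
  assumes "z0 \<noteq> P"
  shows "W_deriv z0 (\<lambda>z. gen (pole_form k z)) (gen (pole_form (Suc k) z0))"
proof (rule W_deriv_gen[OF _ assms])
  fix j
  have of_nat: "aux_const (of_nat n) = of_nat n" for n
    by (induction n) (simp_all add: aux_const_simps)
  define D where "D = subst_fract aux_const (differential u) (aux_point j)"
  have "aux_const (fact (Suc (Suc k))) = of_nat (Suc (Suc k)) * aux_const (fact (Suc k))"
    unfolding fact_Suc[of "Suc k"] aux_const_simps(2) of_nat ..
  \<comment> \<open>The exponent k+2 comes down as a factor and turns (k+1)! into (k+2)!.\<close>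
  then have eq: "- aux_const (fact (Suc (Suc k))) * D
      = of_nat (Suc (Suc k)) * (- aux_const (fact (Suc k)) * D)" by simp
  show "family_deriv z0 (\<lambda>z. form_at_aux (pole_form k z) j) (form_at_aux (pole_form (Suc k) z0) j)"
    unfolding form_at_aux_pole_form D_def[symmetric] eq
    by (rule family_deriv_pole[OF assms aux_coordinate_nonconst])
qed

section \<open>The derivatives of the field b\<close>

definition b_deriv :: "nat \<Rightarrow> proj_line \<Rightarrow> sym \<Rightarrow> sym" where
  "b_deriv k z v = contraction k z v + gen (pole_form k z) * v"

lemma b_hat_eq: "z \<noteq> P \<Longrightarrow> v \<in> W_reg z \<Longrightarrow> b_hat u z v = b_deriv 0 z v"
  by (simp add: b_hat_def b_deriv_def i_hat_eq e_hat_def pole_form_0)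

lemma W_deriv_b_deriv:
  assumes "v \<in> W_reg z0" "z0 \<noteq> P"
  shows "W_deriv z0 (\<lambda>z. b_deriv k z v) (b_deriv (Suc k) z0 v)"
proof -
  have "W_deriv z0 (\<lambda>z. contraction k z v + gen (pole_form k z) * v)
      (contraction (Suc k) z0 v + (gen (pole_form (Suc k) z0) * v + gen (pole_form k z0) * 0))"
    by (intro W_deriv_add W_deriv_mult W_deriv_contraction W_deriv_pole_form W_deriv_const assms)
  then show ?thesis by (simp add: b_deriv_def)
qed

text \<open>\<open>has_u_deriv\<close> sees only components, and derivatives of rational families
  are unique; so every possible choice in \<open>u_deriv\<close> has the components of w.\<close>

lemma component_u_deriv:
  assumes "has_u_deriv u F z w"
  shows "component m (u_deriv u F z) = component m w"
proof (rule family_deriv_unique)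
  have "has_u_deriv u F z (u_deriv u F z)"
    unfolding u_deriv_def by (rule someI[of "has_u_deriv u F z", OF assms])
  then show "family_deriv z (\<lambda>z. component m (F z)) (component m (u_deriv u F z))"
    by (simp add: has_u_deriv_iff)
  show "family_deriv z (\<lambda>z. component m (F z)) (component m w)"
    using assms by (simp add: has_u_deriv_iff)
qed

lemma component_b_hat':
  assumes "v \<in> W_reg z" "z \<noteq> P"
  shows "component m (b_hat' u z v) = component m (b_deriv 1 z v)"
  unfolding b_hat'_def
proof (rule component_u_deriv)
  obtain U where U: "zariski_nhd u z U" "\<forall>y\<in>U. v \<in> W_reg y" using W_reg_nhd[OF assms] by blast
  have "W_deriv z (\<lambda>y. b_hat u y v) (b_deriv 1 z v)"
  proof (rule W_deriv_cong[OF W_deriv_b_deriv[OF assms, of 0, folded One_nat_def] U(1)])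
    show "b_hat u y v = b_deriv 0 y v" if "y \<in> U" for y
      using that U by (intro b_hat_eq) (auto simp: zariski_nhd_iff)
  qed
  then show "has_u_deriv u (\<lambda>y. b_hat u y v) z (b_deriv 1 z v)"
    unfolding has_u_deriv_iff using W_deriv_component assms(2) by blast
qed

text \<open>The family being differentiated, b', is itself known only through its components. The
  comparison with \<open>b_deriv 1\<close> is therefore made by \<open>family_deriv_cong\<close> in
  each degree, not by \<open>W_deriv_cong\<close>.\<close>

lemma component_b_hat'':
  assumes "v \<in> W_reg z" "z \<noteq> P"
  shows "component m (b_hat'' u z v) = component m (b_deriv 2 z v)"
  unfolding b_hat''_def
proof (rule component_u_deriv)
  obtain U where U: "zariski_nhd u z U" "\<forall>y\<in>U. v \<in> W_reg y" using W_reg_nhd[OF assms] by blast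
  have "W_deriv z (\<lambda>y. b_deriv 1 y v) (b_deriv 2 z v)"
    using W_deriv_b_deriv[OF assms, of 1] by (simp add: numeral_2_eq_2)
  then have *: "family_deriv z (\<lambda>y. component m (b_deriv 1 y v)) (component m (b_deriv 2 z v))" for m
    by (rule W_deriv_component[OF _ assms(2)])
  show "has_u_deriv u (\<lambda>y. b_hat' u y v) z (b_deriv 2 z v)"
    unfolding has_u_deriv_iff
  proof
    show "family_deriv z (\<lambda>y. component m (b_hat' u y v)) (component m (b_deriv 2 z v))" for m
    proof (rule family_deriv_cong[OF * U(1)])
      show "component m (b_hat' u y v) = component m (b_deriv 1 y v)" if "y \<in> U" for y
        using that U by (intro component_b_hat') (auto simp: zariski_nhd_iff)
    qed
  qed
qed

section \<open>The operator product\<close>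

lemma e_form_regular:
  assumes "z \<noteq> P" "y \<noteq> P" "value_at u y \<noteq> value_at u z"
  shows "e_form u z \<in> K_reg y"
    and "contraction 0 y (gen (e_form u z)) = scalar (1 / (value_at u y - value_at u z) ^ 2)"
proof -
  define g where "g = u - cst (value_at u z)"
  have g: "regular_at g y" "value_at g y = value_at u y - value_at u z"
    using assms(2) by (simp_all add: g_def regular_at_diff regular_iff regular_at_cst value_at_diff
        value_at_cst)
  then have g2: "regular_at (g ^ 2) y" "value_at (g ^ 2) y = (value_at u y - value_at u z) ^ 2"
    by (simp_all add: power2_eq_square regular_at_mult value_at_mult)
  then have "value_at (g ^ 2) y \<noteq> 0" using assms(3) by simp
  note div = regular_at_divide[OF regular_at_cst[of "- 1"] g2(1) this]
  have eq: "Rep_kform (e_form u z) / differential u = cst (- 1) / g ^ 2"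
    unfolding Rep_e_form[OF not_constant] g_def[symmetric]
    using differential_nonzero by (simp add: cst_simps)
  show "e_form u z \<in> K_reg y"
    unfolding K_reg_iff[OF assms(2)] eq by (rule div(1))
  \<comment> \<open>The minus sign of i cancels the one in \<open>e_form\<close>.\<close>
  show "contraction 0 y (gen (e_form u z)) = scalar (1 / (value_at u y - value_at u z) ^ 2)"
    unfolding contraction_gen funpow_0 eq div(2) g2(2) by (simp add: value_at_cst)
qed

text \<open>The normally ordered part of 2 T(z) b(z1) v: all terms in which i(z) does not hit e at
  z1. At z = z1 the coefficients 1 and 2 add up to the binomial coefficients of S.\<close>

definition regular_part :: "proj_line \<Rightarrow> sym \<Rightarrow> proj_line \<Rightarrow> sym" where
  "regular_part z1 v z =
     contraction 0 z (contraction 0 z (contraction 0 z1 v))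
     + gen (e_form u z1) * contraction 0 z (contraction 0 z v)
     + gen (e_form u z) * gen (e_form u z) * (contraction 0 z1 v + gen (e_form u z1) * v)
     + 2 * (gen (e_form u z) * contraction 0 z (contraction 0 z1 v))
     + 2 * (gen (e_form u z1) * (gen (e_form u z) * contraction 0 z v))"

text \<open>Each summand is a product of families that are differentiable at z1, so nothing has a
  pole there and the limit is the value.\<close>

lemma regular_part_limit:
  assumes "v \<in> W_reg z1" "z1 \<noteq> P"
  shows "family_limit z1 (\<lambda>z. component m (regular_part z1 v z)) (component m (S_hat u z1 v))"
proof -
  note w = contraction_W_reg[OF assms(1), of 0 z1]
  obtain a where a: "W_deriv z1 (\<lambda>z. contraction 0 z (contraction 0 z (contraction 0 z1 v))) a"
    using W_deriv_contraction_twice[OF w assms(2)] by blast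
  obtain b where b: "W_deriv z1 (\<lambda>z. contraction 0 z (contraction 0 z v)) b"
    using W_deriv_contraction_twice[OF assms] by blast
  note e = W_deriv_pole_form[OF assms(2), of 0, unfolded pole_form_0]
  note mult = W_deriv_mult[OF _ _ assms(2)] and cmult = W_deriv_cmult[OF _ assms(2)]
  have "\<exists>d. W_deriv z1 (regular_part z1 v) d"
    unfolding regular_part_def
    by (rule exI, rule W_deriv_add[OF W_deriv_add[OF W_deriv_add[OF W_deriv_add[OF a cmult[OF b]]
            mult[OF mult[OF e e] W_deriv_const[OF assms(2)]]]
            cmult[OF mult[OF e W_deriv_contraction[OF w assms(2)]]]]
          cmult[OF cmult[OF mult[OF e W_deriv_contraction[OF assms]]]]])
  then have "family_limit z1 (\<lambda>z. component m (regular_part z1 v z))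
      (component m (regular_part z1 v z1))"
    using W_deriv_component[OF _ assms(2)] family_limit_of_deriv by blast
  moreover have "S_hat u z1 v = regular_part z1 v z1"
    unfolding S_hat_def regular_part_def e_hat_def numeral_3_eq_3 numeral_2_eq_2 funpow.simps
      o_apply id_apply
    by (simp add: i_hat_eq[OF assms(2)] assms(1) contraction_W_reg algebra_simps)
  ultimately show ?thesis by simp
qed

lemma operator_product:
  assumes "v \<in> W_reg z1" "z1 \<noteq> P" "v \<in> W_reg z" "contraction 0 z1 v \<in> W_reg z" "z \<noteq> P"
    and "value_at u z \<noteq> value_at u z1"
  shows "b_hat u z1 v \<in> W_reg z"
    and "2 * T_hat u z (b_hat u z1 v)
      = regular_part z1 v z + scalar (2 / (value_at u z - value_at u z1) ^ 2) * b_deriv 0 z v"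
proof -
  define e e1 where "e = gen (e_form u z)" "e1 = gen (e_form u z1)"
  note e_defs = this
  define D where "D = contraction 0 z"
  define w where "w = contraction 0 z1 v"
  define r where "r = 1 / (value_at u z - value_at u z1) ^ 2"
  have b: "b_hat u z1 v = w + e1 * v"
    using assms(1,2) by (simp add: b_hat_eq b_deriv_def pole_form_0 w_def e_defs)
  show bW: "b_hat u z1 v \<in> W_reg z"
    unfolding b w_def e_defs using assms e_form_regular(1)[OF assms(2,5,6)]
    by (intro W_reg.intros)
  have De1: "D e1 = scalar r"
    using e_form_regular(2)[OF assms(2,5,6)] by (simp add: D_def e_defs r_def)
  note D = contraction_add[of 0 z, folded D_def] contraction_mult[of 0 z, folded D_def]
    contraction_scalar[of 0 z, folded D_def]
  have Db: "D (w + e1 * v) = D w + (scalar r * v + e1 * D v)"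
    by (simp only: D De1)
  \<comment> \<open>The scalar r is annihilated by D. The cross term arises twice, once from each
    application of D to the factor \<open>e1\<close>.\<close>
  have DDb: "D (D w + (scalar r * v + e1 * D v)) = D (D w) + (2 * scalar r * D v + e1 * D (D v))"
    by (simp add: D De1 algebra_simps)
  have i: "i_hat u z (b_hat u z1 v) = D (w + e1 * v)"
    using i_hat_eq[OF assms(5) bW] by (simp add: b D_def)
  have "D (w + e1 * v) \<in> W_reg z"
    unfolding D_def by (rule contraction_W_reg[OF bW[unfolded b]])
  then have ii: "i_hat u z (D (w + e1 * v)) = D (D (w + e1 * v))"
    using i_hat_eq[OF assms(5)] by (simp add: D_def)
  have two: "2 * (scalar (1 / 2) * x) = x" for x
  proof -
    have "2 * scalar (1 / 2) = 1" by (simp flip: scalar_numeral scalar_mult)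
    then show ?thesis by (metis mult.assoc mult_1)
  qed
  have r2: "scalar (2 / (value_at u z - value_at u z1) ^ 2) = 2 * scalar r"
    by (simp add: r_def flip: scalar_numeral scalar_mult)
  have "2 * T_hat u z (b_hat u z1 v)
      = D (D w) + (2 * scalar r * D v + e1 * D (D v)) + e * (e * (w + e1 * v))
        + 2 * (e * (D w + (scalar r * v + e1 * D v)))"
    unfolding T_hat_def two i[unfolded Db] ii[unfolded Db DDb] e_hat_def e_defs(1)[symmetric]
    unfolding b ..
  \<comment> \<open>The terms carrying r, from i i and from 2 e i, have the same factor 2 and
    combine to the field b at z.\<close>
  also have "\<dots> = regular_part z1 v z + 2 * scalar r * (D v + e * v)"
    unfolding regular_part_def D_def[symmetric] w_def[symmetric] e_defs[symmetric]
    by (simp add: algebra_simps)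
  finally show "2 * T_hat u z (b_hat u z1 v)
      = regular_part z1 v z + scalar (2 / (value_at u z - value_at u z1) ^ 2) * b_deriv 0 z v"
    by (simp only: r2 b_deriv_def pole_form_0 D_def e_defs)
qed

lemma operator_product_limit:
  assumes "v \<in> W_reg z1" "z1 \<noteq> P"
  shows "\<exists>U. zariski_nhd u z1 U \<and> (\<forall>z2 \<in> U - {z1}. b_hat u z1 v \<in> W_reg z2)"
    and "tends_to_W u
      (\<lambda>z2. 2 * T_hat u z2 (b_hat u z1 v)
         - scalar (2 / (value_at u z2 - value_at u z1) ^ 2) * b_hat u z1 v
         - scalar (2 / (value_at u z2 - value_at u z1)) * b_hat' u z1 v)
      z1
      (S_hat u z1 v + b_hat'' u z1 v)" (is "tends_to_W u ?F z1 _")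
proof -
  obtain V where V: "zariski_nhd u z1 V" "\<forall>z\<in>V. v \<in> W_reg z"
    using W_reg_nhd[OF assms] by blast
  obtain V' where V': "zariski_nhd u z1 V'" "\<forall>z\<in>V'. contraction 0 z1 v \<in> W_reg z"
    using W_reg_nhd[OF contraction_W_reg[OF assms(1)] assms(2)] by blast
  define B where "B = {z. z \<noteq> P \<and> value_at u z = value_at u z1} - {z1}"
  have "finite B" unfolding B_def using finite_coordinate_fibre by simp
  define U where "U = V \<inter> V' - B"
  have U: "zariski_nhd u z1 U"
    unfolding U_def using \<open>finite B\<close>
    by (intro zariski_nhd_remove zariski_nhd_Int V V') (simp_all add: B_def)
  have ope: "b_hat u z1 v \<in> W_reg z"
    "2 * T_hat u z (b_hat u z1 v)
      = regular_part z1 v z + scalar (2 / (value_at u z - value_at u z1) ^ 2) * b_deriv 0 z v"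
    "value_at u z \<noteq> value_at u z1" if z: "z \<in> U - {z1}" for z
  proof -
    have "z \<noteq> P" using z U by (auto simp: zariski_nhd_iff)
    moreover from this show "value_at u z \<noteq> value_at u z1" using z by (auto simp: U_def B_def)
    moreover have "v \<in> W_reg z" "contraction 0 z1 v \<in> W_reg z" using z V V' by (auto simp: U_def)
    ultimately show "b_hat u z1 v \<in> W_reg z" "2 * T_hat u z (b_hat u z1 v)
      = regular_part z1 v z + scalar (2 / (value_at u z - value_at u z1) ^ 2) * b_deriv 0 z v"
      using operator_product[OF assms] by blast+
  qed
  then show "\<exists>U. zariski_nhd u z1 U \<and> (\<forall>z2 \<in> U - {z1}. b_hat u z1 v \<in> W_reg z2)"
    using U by blast
  show "tends_to_W u ?F z1 (S_hat u z1 v + b_hat'' u z1 v)"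
    unfolding tends_to_W_iff
  proof
    fix m
    define g where "g z = component m (b_deriv 0 z v)" for z
    define g1 where "g1 z = component m (b_deriv 1 z v)" for z
    \<comment> \<open>The Taylor lemma needs \<open>g1\<close> as derivative throughout a
      neighbourhood, hence V, where v stays in \<open>W_reg y\<close>.\<close>
    have d1: "family_deriv y g (g1 y)" if "y \<in> V" for y
      unfolding g_def g1_def
      using that V W_deriv_component[OF W_deriv_b_deriv[of v y 0]]
      by (auto simp: zariski_nhd_iff)
    have d2: "family_deriv z1 g1 (component m (b_deriv 2 z1 v))"
      unfolding g1_def
      using W_deriv_component[OF W_deriv_b_deriv[OF assms, of 1] assms(2)]
      by (simp add: numeral_2_eq_2)
    have "family_limit z1
        (\<lambda>z. component m (regular_part z1 v z)
          + 2 / (s z - s z1) ^ 2 * (g z - g z1 - (s z - s z1) * g1 z1))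
        (component m (S_hat u z1 v) + component m (b_deriv 2 z1 v))"
      by (intro family_limit_add regular_part_limit assms family_limit_taylor[OF V(1) d1 d2])
    then have "family_limit z1 (\<lambda>z. component m (?F z))
        (component m (S_hat u z1 v) + component m (b_deriv 2 z1 v))"
    proof (rule family_limit_cong[OF _ U])
      fix z assume z: "z \<in> U - {z1}"
      have two: "aux_const 2 = 2" using aux_const_simps(1)[of 1 1] by (simp add: aux_const_simps(3))
      have sc: "aux_const (2 / (value_at u z - value_at u z1) ^ 2) = 2 / (s z - s z1) ^ 2"
        "aux_const (2 / (value_at u z - value_at u z1)) = 2 / (s z - s z1)"
        by (simp_all add: aux_const_divide aux_const_diff aux_const_simps power2_eq_square two)
      have b: "component m (b_hat u z1 v) = g z1" "component m (b_hat' u z1 v) = g1 z1"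
        unfolding g_def g1_def b_hat_eq[OF assms(2,1)] component_b_hat'[OF assms] by (rule refl)+
      have \<Delta>: "s z - s z1 \<noteq> 0" using ope(3)[OF z] by (simp add: aux_const_eq_iff)
      have "component m (?F z) = component m (regular_part z1 v z)
          + 2 / (s z - s z1) ^ 2 * g z - 2 / (s z - s z1) ^ 2 * g z1 - 2 / (s z - s z1) * g1 z1"
        unfolding ope(2)[OF z] component_diff component_add component_scalar sc b
        by (simp only: g_def)
      \<comment> \<open>Putting the simple pole over the double one lets all three singular terms
        merge into the Taylor remainder of g.\<close>
      also have "2 / (s z - s z1) * g1 z1 = 2 / (s z - s z1) ^ 2 * ((s z - s z1) * g1 z1)"
        using \<Delta> by (simp add: power2_eq_square)
      finally show "component m (?F z) = component m (regular_part z1 v z)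
          + 2 / (s z - s z1) ^ 2 * (g z - g z1 - (s z - s z1) * g1 z1)"
        by (simp only: right_diff_distrib) (simp only: algebra_simps)
    qed
    then show "family_limit z1 (\<lambda>z. component m (?F z))
        (component m (S_hat u z1 v + b_hat'' u z1 v))"
      by (simp only: component_add component_b_hat''[OF assms])
  qed
qed

end

theorem proposition4p3:
  fixes u :: mero and P z1 :: proj_line and v :: sym
  assumes "coordinate_with_pole u P"
    and "z1 \<noteq> P"
    and "v \<in> W_reg z1"
  shows "(\<exists>U. zariski_nhd u z1 U \<and> (\<forall>z2 \<in> U - {z1}. b_hat u z1 v \<in> W_reg z2)) \<and>
    tends_to_W u
      (\<lambda>z2. 2 * T_hat u z2 (b_hat u z1 v)
         - scalar (2 / (value_at u z2 - value_at u z1) ^ 2) * b_hat u z1 v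
         - scalar (2 / (value_at u z2 - value_at u z1)) * b_hat' u z1 v)
      z1
      (S_hat u z1 v + b_hat'' u z1 v)"
proof -
  interpret coordinate u P using assms(1) by unfold_locales
  show ?thesis using operator_product_limit[OF assms(3,2)] by blast
qed

end
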